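(* Let $p$ be a prime integer, and let $A$ be either $\mathbb{Z}$ or a discrete valuation ring with uniformizer $p$ that has a $p$-derivation. Let $S=A[x_1,\ldots,x_m]$ be a graded polynomial ring over $A$ with $\deg(x_i)>0$ for all $i$, let $f_1,\ldots,f_t\in S$ be homogeneous elements of positive degree, and let $R=A[f_1,\ldots,f_t]\subseteq S$. Assume that $R$ is a graded direct summand of $S$. Let $\mathfrak{q}=(f_1,\ldots,f_t)R$ and $D=\max\{\deg(f_1),\ldots,\deg(f_t)\}$. Then $Q^{(nD)}\subseteq\mathfrak{q}^n$ for all $n\geq 1$ and all prime ideals $Q$ of $R$ with $Q\subseteq\mathfrak{q}$.
   Context: All rings are commutative with identity. Elements of $A$ have degree $0$ in $S$, and $R=A[f_1,\ldots,f_t]$ is the graded $A$-subalgebra of $S$ generated by $f_1,\ldots,f_t$. $p$-derivation: if $T$ is a ring in which $p$ is a nonzerodivisor, a map of sets $\delta:T\to T$ is a $p$-derivation if the map $\phi_p:T\to T$, $\phi_p(x)=x^p+p\,\delta(x)$, is a ring homomorphism. Graded direct summand: for an inclusion of graded rings $R\subseteq S$, $R$ is a graded direct summand of $S$ if there is a degree-preserving $R$-linear map $\beta:S\to R$ that splits the inclusion (i.e. $\beta|_R=\mathrm{id}_R$). Symbolic powers: for a prime ideal $Q$ of $R$, $Q^{(n)}=Q^nR_Q\cap R$. *)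

theory Defs
  imports
    "HOL-Library.Poly_Mapping"
    "HOL-Algebra.Algebra"
    "HOL-Algebra.Algebraic_Closure_Type"
begin

section \<open>Discrete valuation rings and p-derivations\<close>

locale discrete_valuation_ring = principal_domain R for R (structure) +
  assumes not_field: "\<not> field R"
    and local: "\<exists>!M. maximalideal M R"

definition uniformizer :: "('a, 'b) ring_scheme \<Rightarrow> 'a \<Rightarrow> bool" where
  "uniformizer R \<pi> \<longleftrightarrow> \<pi> \<in> carrier R \<and> maximalideal (PIdl\<^bsub>R\<^esub> \<pi>) R"

text \<open>\<open>ring_hom\<close> includes preservation of the unit element.\<close>

definition p_derivation :: "('a, 'b) ring_scheme \<Rightarrow> nat \<Rightarrow> ('a \<Rightarrow> 'a) \<Rightarrow> bool" where
  "p_derivation T p \<delta> \<longleftrightarrow>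
     (\<forall>x \<in> carrier T. [p] \<cdot>\<^bsub>T\<^esub> x = \<zero>\<^bsub>T\<^esub> \<longrightarrow> x = \<zero>\<^bsub>T\<^esub>) \<and>
     \<delta> \<in> carrier T \<rightarrow> carrier T \<and>
     (\<lambda>x. x [^]\<^bsub>T\<^esub> p \<oplus>\<^bsub>T\<^esub> [p] \<cdot>\<^bsub>T\<^esub> \<delta> x) \<in> ring_hom T T"


section \<open>Polynomial rings and finitely generated subalgebras\<close>

text \<open>
  A polynomial over \<open>'a\<close> is a finitely supported map from exponent vectors to coefficients;
  \<open>mpoly_ring m\<close> is the ring of those polynomials in which only the variables
  with indices \<open>1, \<dots>, m\<close> occur.
\<close>

type_synonym 'a mpol = "(nat \<Rightarrow>\<^sub>0 nat) \<Rightarrow>\<^sub>0 'a"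

definition mpoly_ring :: "nat \<Rightarrow> 'a::comm_ring_1 mpol ring" where
  "mpoly_ring m =
     ring_of_type_algebra \<lparr>carrier :=
       {P. \<forall>\<alpha> \<in> Poly_Mapping.keys P. Poly_Mapping.keys \<alpha> \<subseteq> {1..m}}\<rparr>"

definition subalgebra_ring :: "nat \<Rightarrow> 'a::comm_ring_1 mpol set \<Rightarrow> 'a mpol ring" where
  "subalgebra_ring m F = (mpoly_ring m)
     \<lparr>carrier := generate_ring (mpoly_ring m) (range (Poly_Mapping.single 0) \<union> F)\<rparr>"

text \<open>The degree-\<open>k\<close> part (containing 0) for the grading with \<open>deg x\<^sub>i = w i\<close>.\<close>

definition homogeneous_part :: "(nat \<Rightarrow> nat) \<Rightarrow> nat \<Rightarrow> 'a::comm_ring_1 mpol set" where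
  "homogeneous_part w k =
     {P. \<forall>\<alpha> \<in> Poly_Mapping.keys P.
       (\<Sum>i \<in> Poly_Mapping.keys \<alpha>. w i * Poly_Mapping.lookup \<alpha> i) = k}"

text \<open>
  Here \<open>R\<close> is a graded subring of \<open>S\<close> and \<open>G k\<close> contains the homogeneous elements of
  degree \<open>k\<close>, so the graded pieces are \<open>G k \<inter> carrier S\<close> and \<open>G k \<inter> carrier R\<close>.
\<close>

definition graded_direct_summand ::
  "(nat \<Rightarrow> 'a set) \<Rightarrow> ('a, 'b) ring_scheme \<Rightarrow> ('a, 'c) ring_scheme \<Rightarrow> bool" where
  "graded_direct_summand G R S \<longleftrightarrow>
     (\<exists>\<beta> \<in> hom (add_monoid S) (add_monoid R).
        (\<forall>r \<in> carrier R. \<forall>s \<in> carrier S. \<beta> (r \<otimes>\<^bsub>S\<^esub> s) = r \<otimes>\<^bsub>R\<^esub> \<beta> s) \<and>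
        (\<forall>k. \<beta> ` (G k \<inter> carrier S) \<subseteq> G k \<inter> carrier R) \<and>
        (\<forall>r \<in> carrier R. \<beta> r = r))"


section \<open>Localization at a prime ideal and symbolic powers\<close>

definition loc_rel :: "('a, 'b) ring_scheme \<Rightarrow> 'a set \<Rightarrow> (('a \<times> 'a) \<times> ('a \<times> 'a)) set" where
  "loc_rel R Q = {((a, s), (b, t)).
     a \<in> carrier R \<and> b \<in> carrier R \<and> s \<in> carrier R - Q \<and> t \<in> carrier R - Q \<and>
     (\<exists>u \<in> carrier R - Q. u \<otimes>\<^bsub>R\<^esub> (a \<otimes>\<^bsub>R\<^esub> t \<ominus>\<^bsub>R\<^esub> b \<otimes>\<^bsub>R\<^esub> s) = \<zero>\<^bsub>R\<^esub>)}"

definition loc_frac :: "('a, 'b) ring_scheme \<Rightarrow> 'a set \<Rightarrow> 'a \<Rightarrow> 'a \<Rightarrow> ('a \<times> 'a) set" where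
  "loc_frac R Q a s = loc_rel R Q `` {(a, s)}"

text \<open>
  The unions below range over all representatives; every representative contributes the same
  class, so they amount to the usual formulas for sums and products of fractions.
\<close>

definition localization :: "('a, 'b) ring_scheme \<Rightarrow> 'a set \<Rightarrow> (('a \<times> 'a) set) ring" where
  "localization R Q = \<lparr>
     carrier = (carrier R \<times> (carrier R - Q)) // loc_rel R Q,
     monoid.mult = (\<lambda>U V. \<Union>(a, s) \<in> U. \<Union>(b, t) \<in> V.
        loc_frac R Q (a \<otimes>\<^bsub>R\<^esub> b) (s \<otimes>\<^bsub>R\<^esub> t)),
     one = loc_frac R Q \<one>\<^bsub>R\<^esub> \<one>\<^bsub>R\<^esub>,
     ring.zero = loc_frac R Q \<zero>\<^bsub>R\<^esub> \<one>\<^bsub>R\<^esub>,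
     add = (\<lambda>U V. \<Union>(a, s) \<in> U. \<Union>(b, t) \<in> V.
        loc_frac R Q (a \<otimes>\<^bsub>R\<^esub> t \<oplus>\<^bsub>R\<^esub> b \<otimes>\<^bsub>R\<^esub> s) (s \<otimes>\<^bsub>R\<^esub> t))\<rparr>"

text \<open>
  \<open>ideals_set R\<close> is the semiring of ideals of \<open>R\<close>, so powers in it are powers of ideals.
\<close>

definition symbolic_power :: "('a, 'b) ring_scheme \<Rightarrow> 'a set \<Rightarrow> nat \<Rightarrow> 'a set" where
  "symbolic_power R Q n =
     {r \<in> carrier R. loc_frac R Q r \<one>\<^bsub>R\<^esub> \<in>
        Idl\<^bsub>localization R Q\<^esub> ((\<lambda>a. loc_frac R Q a \<one>\<^bsub>R\<^esub>) ` (Q [^]\<^bsub>ideals_set R\<^esub> n))}"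

end

theory Submission
  imports Defs
begin

text \<open>
  Differentiation is the idea, as in the theorem of Zariski and Nagata.  A polynomial that lies in
  the \<open>N\<close>-th symbolic power of a prime should vanish to order \<open>N\<close>, that is, its derivatives of
  order below \<open>N\<close> should lie in the prime.  Here the derivatives are the divided ones, which make
  sense over every coefficient ring: they are the coefficients of the Taylor expansion
  \<open>r(x + y)\<close> with respect to \<open>y\<close>.  They leave \<open>R\<close>, but the retraction \<open>\<beta>\<close> of \<open>S\<close> onto \<open>R\<close> brings
  them back.

  Let \<open>r\<close> be in the \<open>N\<close>-th symbolic power of \<open>Q\<close>; then \<open>s r\<close> is in the ordinary power \<open>Q\<^sup>N\<close> for
  some \<open>s\<close> in \<open>R\<close> outside \<open>Q\<close> (\<open>extended_ideal_contraction\<close>).  Let \<open>J\<close> be the set of all \<open>h\<close> in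
  \<open>S\<close> such that \<open>\<beta>(g h)\<close> is in \<open>Q\<close> for all \<open>g\<close> in \<open>S\<close>.  This is an ideal of \<open>S\<close> containing \<open>Q\<close>, and
  the linearity of \<open>\<beta>\<close> shows that elements of \<open>R\<close> outside \<open>Q\<close> can be cancelled modulo \<open>J\<close>.  The Taylor
  expansion is multiplicative and sends every element of \<open>Q\<close> to a polynomial in \<open>y\<close> with constant
  coefficient in \<open>J\<close>; so modulo \<open>J\<close> the expansion of \<open>s r\<close> has no terms of degree below \<open>N\<close> in
  \<open>y\<close>.  The lowest coefficient of the expansion of \<open>s\<close> is \<open>s\<close> itself and can be cancelled, which
  gives the same for the expansion of \<open>r\<close>.

  Now \<open>Q \<subseteq> \<qq>\<close> enters.  Elements of \<open>\<qq>\<close> have constant term \<open>0\<close>, and since \<open>\<beta>\<close> is graded it does not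
  change constant terms, so elements of \<open>J\<close> have constant term \<open>0\<close> as well.  But the constant term
  of the coefficient of \<open>y\<^sup>\<alpha>\<close> in \<open>r(x + y)\<close> is the coefficient of \<open>x\<^sup>\<alpha>\<close> in \<open>r\<close>.  Hence every
  monomial of \<open>r\<close> has at least \<open>N\<close> factors (\<open>symbolic_power_order\<close>), and its weighted degree is at
  least \<open>N\<close> because the weights are positive.

  For \<open>N = n D\<close> this finishes the proof: \<open>r\<close> is an \<open>A\<close>-linear combination of products of the
  \<open>f\<^sub>j\<close>, the products of degree below \<open>n D\<close> cancel, and each of the others has at least \<open>n\<close> factors
  because each factor has degree at most \<open>D\<close> (\<open>high_degree_mem_ideal_power\<close>).
\<close>

section \<open>Localization at a prime ideal\<close>

context primeideal begin

lemma denominators_closed: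
  "\<one> \<in> carrier R - I" "s \<in> carrier R - I \<Longrightarrow> t \<in> carrier R - I \<Longrightarrow> s \<otimes> t \<in> carrier R - I"
  using I_prime I_notcarr one_imp_carrier by auto

lemma denominators_notin:
  "\<one> \<notin> I"
  "s \<in> carrier R \<Longrightarrow> t \<in> carrier R \<Longrightarrow> s \<notin> I \<Longrightarrow> t \<notin> I \<Longrightarrow> s \<otimes> t \<notin> I"
  using denominators_closed by auto

lemma loc_rel_iff:
  "((a, s), (b, t)) \<in> loc_rel R I \<longleftrightarrow>
     a \<in> carrier R \<and> b \<in> carrier R \<and> s \<in> carrier R - I \<and> t \<in> carrier R - I \<and>
     (\<exists>u \<in> carrier R - I. u \<otimes> (a \<otimes> t) = u \<otimes> (b \<otimes> s))"
proof -
  have "u \<otimes> (x \<ominus> y) = \<zero> \<longleftrightarrow> u \<otimes> x = u \<otimes> y"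
    if "u \<in> carrier R" "x \<in> carrier R" "y \<in> carrier R" for u x y
    using that by (metis m_closed minus_eq r_distr r_minus r_right_minus_eq a_inv_closed)
  then show ?thesis
    unfolding loc_rel_def by fastforce
qed

text \<open>
  The middle denominator \<open>t\<close> has to be part of the multiplier, since it cannot be cancelled from the
  product of the two equations.
\<close>

lemma cross_equation_trans:
  assumes "a \<in> carrier R" "b \<in> carrier R" "c \<in> carrier R" "s \<in> carrier R" "t \<in> carrier R"
    "r \<in> carrier R" "u \<in> carrier R" "v \<in> carrier R"
    and u: "u \<otimes> (a \<otimes> t) = u \<otimes> (b \<otimes> s)" and v: "v \<otimes> (b \<otimes> r) = v \<otimes> (c \<otimes> t)"
  shows "(u \<otimes> v \<otimes> t) \<otimes> (a \<otimes> r) = (u \<otimes> v \<otimes> t) \<otimes> (c \<otimes> s)"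
proof -
  have "(u \<otimes> v \<otimes> t) \<otimes> (a \<otimes> r) = (u \<otimes> (a \<otimes> t)) \<otimes> (v \<otimes> r)"
    using assms(1-8) by (simp add: m_ac)
  also have "\<dots> = (v \<otimes> (b \<otimes> r)) \<otimes> (u \<otimes> s)"
    unfolding u using assms(1-8) by (simp add: m_ac)
  also have "\<dots> = (u \<otimes> v \<otimes> t) \<otimes> (c \<otimes> s)"
    unfolding v using assms(1-8) by (simp add: m_ac)
  finally show ?thesis .
qed

lemma equiv_loc_rel: "equiv (carrier R \<times> (carrier R - I)) (loc_rel R I)"
proof (rule equivI)
  show "loc_rel R I \<subseteq> (carrier R \<times> (carrier R - I)) \<times> (carrier R \<times> (carrier R - I))"
    unfolding loc_rel_def by auto
  show "refl_on (carrier R \<times> (carrier R - I)) (loc_rel R I)"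
    using denominators_closed by (auto simp: refl_on_def loc_rel_iff)
  show "sym (loc_rel R I)"
    by (force simp: sym_def loc_rel_iff)
  show "trans (loc_rel R I)"
  proof (rule transI, clarify)
    fix a s b t c r
    assume "((a, s), (b, t)) \<in> loc_rel R I" "((b, t), (c, r)) \<in> loc_rel R I"
    then obtain u v where uv: "u \<in> carrier R - I" "v \<in> carrier R - I"
      and eq: "u \<otimes> (a \<otimes> t) = u \<otimes> (b \<otimes> s)" "v \<otimes> (b \<otimes> r) = v \<otimes> (c \<otimes> t)"
      and carr: "a \<in> carrier R" "b \<in> carrier R" "c \<in> carrier R"
        "s \<in> carrier R - I" "t \<in> carrier R - I" "r \<in> carrier R - I"
      unfolding loc_rel_iff by blast
    have "(u \<otimes> v \<otimes> t) \<otimes> (a \<otimes> r) = (u \<otimes> v \<otimes> t) \<otimes> (c \<otimes> s)"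
      using uv carr eq by (intro cross_equation_trans[of _ b]) auto
    moreover have "u \<otimes> v \<otimes> t \<in> carrier R - I"
      using uv carr denominators_closed(2) by blast
    ultimately show "((a, s), (c, r)) \<in> loc_rel R I"
      unfolding loc_rel_iff using carr by blast
  qed
qed

lemma loc_frac_eqI:
  assumes "a \<in> carrier R" "b \<in> carrier R" "s \<in> carrier R - I" "t \<in> carrier R - I"
    "u \<in> carrier R - I" "u \<otimes> (a \<otimes> t) = u \<otimes> (b \<otimes> s)"
  shows "loc_frac R I a s = loc_frac R I b t"
  unfolding loc_frac_def
  by (rule equiv_class_eq[OF equiv_loc_rel]) (use assms in \<open>auto simp: loc_rel_iff\<close>)

lemma loc_frac_eqD:
  assumes "a \<in> carrier R" "b \<in> carrier R" "s \<in> carrier R - I" "t \<in> carrier R - I"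
    "loc_frac R I a s = loc_frac R I b t"
  obtains u where "u \<in> carrier R - I" "u \<otimes> (a \<otimes> t) = u \<otimes> (b \<otimes> s)"
  using eq_equiv_class[OF assms(5)[unfolded loc_frac_def] equiv_loc_rel] assms(2,4)
  by (auto simp: loc_rel_iff)

lemma loc_frac_in_carrier:
  "a \<in> carrier R \<Longrightarrow> s \<in> carrier R - I \<Longrightarrow> loc_frac R I a s \<in> carrier (localization R I)"
  unfolding localization_def loc_frac_def by (auto intro!: quotientI)

lemma loc_frac_cases:
  assumes "U \<in> carrier (localization R I)"
  obtains a s where "a \<in> carrier R" "s \<in> carrier R - I" "U = loc_frac R I a s"
  using assms unfolding localization_def loc_frac_def by (auto elim!: quotientE)

text \<open>
  The next two lemmas say that products and sums of fractions do not depend on the representatives,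
  so that all members of the unions that define the operations of the localization coincide.
\<close>

lemma loc_frac_eq_mult:
  assumes "((a, s), (a', s')) \<in> loc_rel R I" "((b, t), (b', t')) \<in> loc_rel R I"
  shows "loc_frac R I (a' \<otimes> b') (s' \<otimes> t') = loc_frac R I (a \<otimes> b) (s \<otimes> t)"
proof -
  obtain u v where uv: "u \<in> carrier R - I" "v \<in> carrier R - I"
    and eq: "u \<otimes> (a \<otimes> s') = u \<otimes> (a' \<otimes> s)" "v \<otimes> (b \<otimes> t') = v \<otimes> (b' \<otimes> t)"
    and carr: "a \<in> carrier R" "b \<in> carrier R" "a' \<in> carrier R" "b' \<in> carrier R"
      "s \<in> carrier R - I" "t \<in> carrier R - I" "s' \<in> carrier R - I" "t' \<in> carrier R - I"
    using assms unfolding loc_rel_iff by blast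
  note carr' = carr(1-4) carr(5-8)[THEN DiffD1] uv[THEN DiffD1]
  have "(u \<otimes> v) \<otimes> ((a' \<otimes> b') \<otimes> (s \<otimes> t)) = (u \<otimes> (a' \<otimes> s)) \<otimes> (v \<otimes> (b' \<otimes> t))"
    using carr' by (simp add: m_ac)
  also have "\<dots> = (u \<otimes> v) \<otimes> ((a \<otimes> b) \<otimes> (s' \<otimes> t'))"
    unfolding eq[symmetric] using carr' by (simp add: m_ac)
  finally show ?thesis
    by (intro loc_frac_eqI[of _ _ _ _ "u \<otimes> v"] denominators_closed(2) uv carr m_closed carr')
qed

lemma loc_frac_eq_add:
  assumes "((a, s), (a', s')) \<in> loc_rel R I" "((b, t), (b', t')) \<in> loc_rel R I"
  shows "loc_frac R I (a' \<otimes> t' \<oplus> b' \<otimes> s') (s' \<otimes> t') = loc_frac R I (a \<otimes> t \<oplus> b \<otimes> s) (s \<otimes> t)"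
proof -
  obtain u v where uv: "u \<in> carrier R - I" "v \<in> carrier R - I"
    and eq: "u \<otimes> (a \<otimes> s') = u \<otimes> (a' \<otimes> s)" "v \<otimes> (b \<otimes> t') = v \<otimes> (b' \<otimes> t)"
    and carr: "a \<in> carrier R" "b \<in> carrier R" "a' \<in> carrier R" "b' \<in> carrier R"
      "s \<in> carrier R - I" "t \<in> carrier R - I" "s' \<in> carrier R - I" "t' \<in> carrier R - I"
    using assms unfolding loc_rel_iff by blast
  note carr' = carr(1-4) carr(5-8)[THEN DiffD1] uv[THEN DiffD1]
  have "(u \<otimes> v) \<otimes> ((a' \<otimes> t' \<oplus> b' \<otimes> s') \<otimes> (s \<otimes> t))
      = (u \<otimes> (a' \<otimes> s)) \<otimes> (v \<otimes> (t \<otimes> t')) \<oplus> (v \<otimes> (b' \<otimes> t)) \<otimes> (u \<otimes> (s \<otimes> s'))"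
    using carr' by (simp add: l_distr r_distr m_ac)
  also have "\<dots> = (u \<otimes> v) \<otimes> ((a \<otimes> t \<oplus> b \<otimes> s) \<otimes> (s' \<otimes> t'))"
    unfolding eq[symmetric] using carr' by (simp add: l_distr r_distr m_ac)
  finally show ?thesis
    by (intro loc_frac_eqI[of _ _ _ _ "u \<otimes> v"] denominators_closed(2) uv carr m_closed a_closed carr')
qed

lemma UN_pairs_constant:
  assumes "(a, s) \<in> U" "(b, t) \<in> V"
    and "\<And>a s b t. (a, s) \<in> U \<Longrightarrow> (b, t) \<in> V \<Longrightarrow> f a s b t = C"
  shows "(\<Union>(a, s) \<in> U. \<Union>(b, t) \<in> V. f a s b t) = C"
  using assms by fastforce

lemma mem_loc_frac: "(b, t) \<in> loc_frac R I a s \<longleftrightarrow> ((a, s), (b, t)) \<in> loc_rel R I"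
  by (simp add: loc_frac_def)

lemma mem_loc_frac_self:
  "a \<in> carrier R \<Longrightarrow> s \<in> carrier R - I \<Longrightarrow> (a, s) \<in> loc_frac R I a s"
  using denominators_closed(1) by (auto simp: mem_loc_frac loc_rel_iff)

lemma loc_frac_mult:
  assumes "a \<in> carrier R" "b \<in> carrier R" "s \<in> carrier R - I" "t \<in> carrier R - I"
  shows "loc_frac R I a s \<otimes>\<^bsub>localization R I\<^esub> loc_frac R I b t = loc_frac R I (a \<otimes> b) (s \<otimes> t)"
  unfolding localization_def monoid.simps
  by (rule UN_pairs_constant[OF mem_loc_frac_self mem_loc_frac_self])
    (use assms in \<open>simp_all add: mem_loc_frac loc_frac_eq_mult\<close>)

lemma loc_frac_add:
  assumes "a \<in> carrier R" "b \<in> carrier R" "s \<in> carrier R - I" "t \<in> carrier R - I"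
  shows "loc_frac R I a s \<oplus>\<^bsub>localization R I\<^esub> loc_frac R I b t
       = loc_frac R I (a \<otimes> t \<oplus> b \<otimes> s) (s \<otimes> t)"
  unfolding localization_def ring.simps
  by (rule UN_pairs_constant[OF mem_loc_frac_self mem_loc_frac_self])
    (use assms in \<open>simp_all add: mem_loc_frac loc_frac_eq_add\<close>)

lemma cring_localization: "cring (localization R I)"
proof (rule cringI)
  note frac = loc_frac_in_carrier loc_frac_mult loc_frac_add denominators_notin
  have zero: "\<zero>\<^bsub>localization R I\<^esub> = loc_frac R I \<zero> \<one>"
    and one: "\<one>\<^bsub>localization R I\<^esub> = loc_frac R I \<one> \<one>"
    by (simp_all add: localization_def)
  show "comm_monoid (localization R I)"
  proof (rule comm_monoidI)
    show "\<one>\<^bsub>localization R I\<^esub> \<in> carrier (localization R I)"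
      by (simp add: one frac)
  next
    fix U assume "U \<in> carrier (localization R I)"
    then show "\<one>\<^bsub>localization R I\<^esub> \<otimes>\<^bsub>localization R I\<^esub> U = U"
      by (elim loc_frac_cases) (simp add: one frac)
  next
    fix U V assume "U \<in> carrier (localization R I)" "V \<in> carrier (localization R I)"
    then show "U \<otimes>\<^bsub>localization R I\<^esub> V \<in> carrier (localization R I)"
      and "U \<otimes>\<^bsub>localization R I\<^esub> V = V \<otimes>\<^bsub>localization R I\<^esub> U"
      by (elim loc_frac_cases; simp add: frac m_comm)+
  next
    fix U V W
    assume "U \<in> carrier (localization R I)" "V \<in> carrier (localization R I)"
      "W \<in> carrier (localization R I)"
    then show "U \<otimes>\<^bsub>localization R I\<^esub> V \<otimes>\<^bsub>localization R I\<^esub> W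
             = U \<otimes>\<^bsub>localization R I\<^esub> (V \<otimes>\<^bsub>localization R I\<^esub> W)"
      by (elim loc_frac_cases) (simp add: frac m_assoc)
  qed
  show "abelian_group (localization R I)"
  proof (rule abelian_groupI)
    show "\<zero>\<^bsub>localization R I\<^esub> \<in> carrier (localization R I)"
      by (simp add: zero frac)
  next
    fix U assume "U \<in> carrier (localization R I)"
    then obtain a s where U: "a \<in> carrier R" "s \<in> carrier R - I" "U = loc_frac R I a s"
      by (rule loc_frac_cases)
    show "\<zero>\<^bsub>localization R I\<^esub> \<oplus>\<^bsub>localization R I\<^esub> U = U"
      using U by (simp add: zero frac)
    have "loc_frac R I (\<ominus> a) s \<oplus>\<^bsub>localization R I\<^esub> U = loc_frac R I (\<ominus> a \<otimes> s \<oplus> a \<otimes> s) (s \<otimes> s)"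
      using U by (simp add: frac)
    also have "\<ominus> a \<otimes> s \<oplus> a \<otimes> s = \<zero>"
      using U by (simp add: l_minus l_neg)
    also have "loc_frac R I \<zero> (s \<otimes> s) = loc_frac R I \<zero> \<one>"
      using U by (intro loc_frac_eqI[of _ _ _ _ \<one>]) (auto simp: denominators_notin)
    finally show "\<exists>V \<in> carrier (localization R I). V \<oplus>\<^bsub>localization R I\<^esub> U = \<zero>\<^bsub>localization R I\<^esub>"
      using U by (intro bexI[of _ "loc_frac R I (\<ominus> a) s"]) (simp_all add: zero frac)
  next
    fix U V assume UVW: "U \<in> carrier (localization R I)" "V \<in> carrier (localization R I)"
    obtain a s where U: "a \<in> carrier R" "s \<in> carrier R - I" "U = loc_frac R I a s"
      using UVW(1) by (rule loc_frac_cases)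
  obtain b t where V: "b \<in> carrier R" "t \<in> carrier R - I" "V = loc_frac R I b t"
    using UVW(2) by (rule loc_frac_cases)
    show "U \<oplus>\<^bsub>localization R I\<^esub> V \<in> carrier (localization R I)"
      using U V by (simp add: frac)
    show "U \<oplus>\<^bsub>localization R I\<^esub> V = V \<oplus>\<^bsub>localization R I\<^esub> U"
      using U V by (simp add: frac) (simp add: m_comm a_comm)
  next
    fix U V W
    assume UVW: "U \<in> carrier (localization R I)" "V \<in> carrier (localization R I)"
      "W \<in> carrier (localization R I)"
    obtain a s where U: "a \<in> carrier R" "s \<in> carrier R - I" "U = loc_frac R I a s"
      using UVW(1) by (rule loc_frac_cases)
  obtain b t where V: "b \<in> carrier R" "t \<in> carrier R - I" "V = loc_frac R I b t"
    using UVW(2) by (rule loc_frac_cases)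
  obtain c r where W: "c \<in> carrier R" "r \<in> carrier R - I" "W = loc_frac R I c r"
    using UVW(3) by (rule loc_frac_cases)
    have "s \<otimes> t \<in> carrier R - I" "t \<otimes> r \<in> carrier R - I"
      using U V W by (simp_all add: frac)
    then show "U \<oplus>\<^bsub>localization R I\<^esub> V \<oplus>\<^bsub>localization R I\<^esub> W
             = U \<oplus>\<^bsub>localization R I\<^esub> (V \<oplus>\<^bsub>localization R I\<^esub> W)"
      using U V W by (simp add: frac) (simp add: l_distr r_distr m_ac a_ac)
  qed
  fix U V W
  assume UVW: "U \<in> carrier (localization R I)" "V \<in> carrier (localization R I)"
    "W \<in> carrier (localization R I)"
  obtain a s where U: "a \<in> carrier R" "s \<in> carrier R - I" "U = loc_frac R I a s"
      using UVW(1) by (rule loc_frac_cases)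
  obtain b t where V: "b \<in> carrier R" "t \<in> carrier R - I" "V = loc_frac R I b t"
    using UVW(2) by (rule loc_frac_cases)
  obtain c r where W: "c \<in> carrier R" "r \<in> carrier R - I" "W = loc_frac R I c r"
    using UVW(3) by (rule loc_frac_cases)
  have den: "s \<otimes> t \<in> carrier R - I" "s \<otimes> r \<in> carrier R - I" "t \<otimes> r \<in> carrier R - I"
    using U V W by (simp_all add: frac)
  have "loc_frac R I ((a \<otimes> t \<oplus> b \<otimes> s) \<otimes> c) (s \<otimes> t \<otimes> r)
      = loc_frac R I ((a \<otimes> c) \<otimes> (t \<otimes> r) \<oplus> (b \<otimes> c) \<otimes> (s \<otimes> r)) ((s \<otimes> r) \<otimes> (t \<otimes> r))"
    using U V W den
    by (intro loc_frac_eqI[of _ _ _ _ \<one>] denominators_closed)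
      (simp_all add: l_distr r_distr m_ac)
  then show "(U \<oplus>\<^bsub>localization R I\<^esub> V) \<otimes>\<^bsub>localization R I\<^esub> W
      = U \<otimes>\<^bsub>localization R I\<^esub> W \<oplus>\<^bsub>localization R I\<^esub> V \<otimes>\<^bsub>localization R I\<^esub> W"
    using U V W den by (simp add: frac)
qed

text \<open>
  The fractions with numerator in \<open>J\<close> already form an ideal of the localization, hence they exhaust
  the extension of \<open>J\<close>.  An equation between \<open>r / 1\<close> and such a fraction yields the multiplier.
\<close>

lemma extended_ideal_contraction:
  assumes J: "ideal J R" and r: "r \<in> carrier R"
    and mem: "loc_frac R I r \<one> \<in> Idl\<^bsub>localization R I\<^esub> ((\<lambda>a. loc_frac R I a \<one>) ` J)"
  obtains s where "s \<in> carrier R - I" "s \<otimes> r \<in> J"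
proof -
  interpret J: ideal J R by fact
  interpret L: cring "localization R I" by (rule cring_localization)
  define E where "E = {loc_frac R I a s | a s. a \<in> J \<and> s \<in> carrier R - I}"
  note frac = loc_frac_in_carrier loc_frac_mult loc_frac_add denominators_notin
  have EI: "loc_frac R I a s \<in> E" if "a \<in> J" "s \<in> carrier R - I" for a s
    using that unfolding E_def by blast
  have mult: "U \<otimes>\<^bsub>localization R I\<^esub> V \<in> E" if UV: "U \<in> carrier (localization R I)" "V \<in> E" for U V
  proof -
    obtain a s where U: "a \<in> carrier R" "s \<in> carrier R - I" "U = loc_frac R I a s"
      using UV(1) by (rule loc_frac_cases)
    obtain b t where V: "b \<in> J" "t \<in> carrier R - I" "V = loc_frac R I b t"
      using UV(2) unfolding E_def by blast
    have "U \<otimes>\<^bsub>localization R I\<^esub> V = loc_frac R I (a \<otimes> b) (s \<otimes> t)"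
      using U V J.Icarr by (simp add: frac)
    also have "\<dots> \<in> E"
      using U V by (intro EI J.I_l_closed denominators_closed)
    finally show ?thesis .
  qed
  have sub: "E \<subseteq> carrier (localization R I)"
    using J.Icarr by (auto simp: E_def intro!: frac)
  have add: "U \<oplus>\<^bsub>localization R I\<^esub> V \<in> E" if UV: "U \<in> E" "V \<in> E" for U V
  proof -
    obtain a s b t where U: "a \<in> J" "s \<in> carrier R - I" "U = loc_frac R I a s"
      and V: "b \<in> J" "t \<in> carrier R - I" "V = loc_frac R I b t"
      using UV unfolding E_def by blast
    have "U \<oplus>\<^bsub>localization R I\<^esub> V = loc_frac R I (a \<otimes> t \<oplus> b \<otimes> s) (s \<otimes> t)"
      using U V J.Icarr by (simp add: frac)
    also have "\<dots> \<in> E"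
      using U V by (intro EI J.a_closed J.I_r_closed denominators_closed) auto
    finally show ?thesis .
  qed
  have "ideal E (localization R I)"
  proof (rule idealI)
    show "subgroup E (add_monoid (localization R I))"
    proof (rule L.add.subgroupI)
      show "E \<noteq> {}" using EI J.zero_closed denominators_closed(1) by blast
      fix U assume U: "U \<in> E"
      then have "\<ominus>\<^bsub>localization R I\<^esub> U = (\<ominus>\<^bsub>localization R I\<^esub> \<one>\<^bsub>localization R I\<^esub>) \<otimes>\<^bsub>localization R I\<^esub> U"
        using sub by (simp add: L.l_minus subset_iff)
      then show "\<ominus>\<^bsub>localization R I\<^esub> U \<in> E"
        using mult U by simp
    qed (use sub add in auto)
    show "U \<otimes>\<^bsub>localization R I\<^esub> V \<in> E"
      if "U \<in> E" "V \<in> carrier (localization R I)" for U V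
      using mult[OF that(2,1)] L.m_comm[OF subsetD[OF sub that(1)] that(2)] by simp
  qed (use mult L.ring_axioms in auto)
  then have "loc_frac R I r \<one> \<in> E"
    using mem EI denominators_closed(1) unfolding genideal_def by blast
  then obtain a s where a: "a \<in> J" "s \<in> carrier R - I" "loc_frac R I r \<one> = loc_frac R I a s"
    unfolding E_def by blast
  then obtain u where u: "u \<in> carrier R - I" "u \<otimes> (r \<otimes> s) = u \<otimes> (a \<otimes> \<one>)"
    using r J.Icarr denominators_closed(1) by (metis loc_frac_eqD)
  have "u \<otimes> s \<otimes> r = u \<otimes> a"
    using u a r J.Icarr by (simp add: m_ac)
  then show ?thesis
    using that[of "u \<otimes> s"] u(1) a J.I_l_closed denominators_notin(2) by auto
qed
end

section \<open>Taylor expansion of polynomials\<close>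

lemma poly_mapping_expansion:
  "P = (\<Sum>\<alpha> \<in> Poly_Mapping.keys P. Poly_Mapping.single \<alpha> (Poly_Mapping.lookup P \<alpha>))"
  by (rule poly_mapping_eqI) (simp add: lookup_sum lookup_single when_def in_keys_iff)

lemma times_expansion:
  fixes P Q :: "'a::comm_ring_1 mpol"
  shows "P * Q = (\<Sum>\<alpha> \<in> Poly_Mapping.keys P. \<Sum>\<beta> \<in> Poly_Mapping.keys Q.
    Poly_Mapping.single (\<alpha> + \<beta>) (Poly_Mapping.lookup P \<alpha> * Poly_Mapping.lookup Q \<beta>))"
  by (subst poly_mapping_expansion[of P], subst poly_mapping_expansion[of Q])
    (simp only: sum_product mult_single)

lemma lookup_times:
  fixes P Q :: "'a::comm_ring_1 mpol"
  shows "Poly_Mapping.lookup (P * Q) \<gamma> = (\<Sum>\<alpha> \<in> Poly_Mapping.keys P. \<Sum>\<beta> \<in> Poly_Mapping.keys Q.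
    Poly_Mapping.lookup P \<alpha> * Poly_Mapping.lookup Q \<beta> when \<alpha> + \<beta> = \<gamma>)"
  by (subst times_expansion) (simp add: lookup_sum lookup_single)

definition monomial_value :: "(nat \<Rightarrow> 'b::comm_ring_1) \<Rightarrow> (nat \<Rightarrow>\<^sub>0 nat) \<Rightarrow> 'b" where
  "monomial_value g \<alpha> = (\<Prod>i \<in> Poly_Mapping.keys \<alpha>. g i ^ Poly_Mapping.lookup \<alpha> i)"

lemma monomial_value_superset:
  assumes "finite A" "Poly_Mapping.keys \<alpha> \<subseteq> A"
  shows "monomial_value g \<alpha> = (\<Prod>i \<in> A. g i ^ Poly_Mapping.lookup \<alpha> i)"
  unfolding monomial_value_def
  by (rule prod.mono_neutral_left) (use assms in \<open>auto simp: in_keys_iff\<close>)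

lemma monomial_value_add:
  "monomial_value g (\<alpha> + \<beta>) = monomial_value g \<alpha> * monomial_value g \<beta>"
proof -
  let ?A = "Poly_Mapping.keys \<alpha> \<union> Poly_Mapping.keys \<beta>"
  have "Poly_Mapping.keys (\<alpha> + \<beta>) \<subseteq> ?A" by (rule keys_add)
  then show ?thesis
    by (simp add: monomial_value_superset[of ?A] lookup_add power_add prod.distrib)
qed

lemma monomial_value_variables:
  "monomial_value (\<lambda>i. Poly_Mapping.single (Poly_Mapping.single i 1) (1::'a::comm_ring_1)) \<alpha>
     = Poly_Mapping.single \<alpha> 1"
proof -
  have pow: "Poly_Mapping.single (Poly_Mapping.single i 1) (1::'a) ^ n
      = Poly_Mapping.single (Poly_Mapping.single i n) 1" for i n :: nat
    by (induction n) (simp_all add: mult_single flip: single_add)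
  have "(\<Prod>i \<in> A. Poly_Mapping.single (f i) (1::'a)) = Poly_Mapping.single (\<Sum>i \<in> A. f i) 1"
    if "finite A" for A :: "nat set" and f :: "nat \<Rightarrow> nat \<Rightarrow>\<^sub>0 nat"
    using that by induction (simp_all add: mult_single)
  then show ?thesis
    unfolding monomial_value_def pow by (simp flip: poly_mapping_expansion)
qed

text \<open>
  Both specializations of the Taylor expansion used below, \<open>y = 0\<close> and \<open>x = 0\<close>, are multiplicative
  maps; this lemma moves them to the variables.
\<close>

lemma monomial_value_image:
  assumes "h 1 = 1" "\<And>a b. h (a * b) = h a * h b"
  shows "h (monomial_value g \<alpha>) = monomial_value (\<lambda>i. h (g i)) \<alpha>"
proof -
  have pow: "h (x ^ n) = h x ^ n" for x n
    by (induction n) (simp_all add: assms)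
  have "h (\<Prod>i \<in> A. f i) = (\<Prod>i \<in> A. h (f i))" if "finite A" for A :: "nat set" and f
    using that by induction (simp_all add: assms)
  then show ?thesis
    unfolding monomial_value_def by (simp add: pow)
qed

text \<open>
  In \<open>'a mpol mpol\<close> the inner exponents belong to the variables \<open>x\<^sub>i\<close> and the outer ones to new
  variables \<open>y\<^sub>i\<close>.  The element below is \<open>x\<^sub>i + y\<^sub>i\<close>, so \<open>taylor P\<close> is \<open>P(x + y)\<close> and its outer
  coefficients are the divided partial derivatives of \<open>P\<close>.
\<close>

abbreviation shifted_variable :: "nat \<Rightarrow> 'a::comm_ring_1 mpol mpol" where
  "shifted_variable i \<equiv> Poly_Mapping.single 0 (Poly_Mapping.single (Poly_Mapping.single i 1) 1)
     + Poly_Mapping.single (Poly_Mapping.single i 1) 1"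

definition taylor :: "'a::comm_ring_1 mpol \<Rightarrow> 'a mpol mpol" where
  "taylor P = (\<Sum>\<alpha> \<in> Poly_Mapping.keys P.
     Poly_Mapping.single 0 (Poly_Mapping.single 0 (Poly_Mapping.lookup P \<alpha>)) *
     monomial_value shifted_variable \<alpha>)"

lemma taylor_superset:
  assumes "finite A" "Poly_Mapping.keys P \<subseteq> A"
  shows "taylor P = (\<Sum>\<alpha> \<in> A.
     Poly_Mapping.single 0 (Poly_Mapping.single 0 (Poly_Mapping.lookup P \<alpha>)) *
     monomial_value shifted_variable \<alpha>)"
  unfolding taylor_def
  by (rule sum.mono_neutral_left) (use assms in \<open>auto simp: in_keys_iff\<close>)

lemma taylor_zero [simp]: "taylor 0 = 0"
  by (simp add: taylor_def)

lemma taylor_add: "taylor (P + Q) = taylor P + taylor Q"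
proof -
  let ?A = "Poly_Mapping.keys P \<union> Poly_Mapping.keys Q"
  have "Poly_Mapping.keys (P + Q) \<subseteq> ?A" by (rule keys_add)
  then show ?thesis
    by (simp add: taylor_superset[of ?A] lookup_add single_add algebra_simps sum.distrib)
qed

lemma taylor_sum: "taylor (\<Sum>x \<in> A. f x) = (\<Sum>x \<in> A. taylor (f x))"
  by (induction A rule: infinite_finite_induct) (simp_all add: taylor_add)

lemma taylor_single:
  "taylor (Poly_Mapping.single \<alpha> c) = Poly_Mapping.single 0 (Poly_Mapping.single 0 c) *
     monomial_value shifted_variable \<alpha>"
  by (simp add: taylor_superset[of "{\<alpha>}"])

lemma taylor_mult: "taylor (P * Q) = taylor P * taylor Q"
proof -
  have "taylor (P * Q) = (\<Sum>\<alpha> \<in> Poly_Mapping.keys P. \<Sum>\<beta> \<in> Poly_Mapping.keys Q.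
      taylor (Poly_Mapping.single \<alpha> (Poly_Mapping.lookup P \<alpha>)) *
      taylor (Poly_Mapping.single \<beta> (Poly_Mapping.lookup Q \<beta>)))"
  proof -
    have "taylor (Poly_Mapping.single (\<alpha> + \<beta>) (c * d))
        = taylor (Poly_Mapping.single \<alpha> c) * taylor (Poly_Mapping.single \<beta> d)"
      for \<alpha> \<beta> and c d :: 'a
    proof -
      have "Poly_Mapping.single 0 (Poly_Mapping.single 0 (c * d))
          = Poly_Mapping.single 0 (Poly_Mapping.single 0 c) *
            Poly_Mapping.single (0 :: nat \<Rightarrow>\<^sub>0 nat) (Poly_Mapping.single (0 :: nat \<Rightarrow>\<^sub>0 nat) d)"
        by (simp add: mult_single)
      then show ?thesis
        unfolding taylor_single monomial_value_add by (simp only: ac_simps)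
    qed
    then show ?thesis
      by (subst times_expansion) (simp only: taylor_sum)
  qed
  also have "\<dots> = taylor P * taylor Q"
    by (subst (3) poly_mapping_expansion, subst (4) poly_mapping_expansion)
      (simp only: taylor_sum sum_product)
  finally show ?thesis .
qed

lemma lookup_times_zero:
  fixes P Q :: "'a::comm_ring_1 mpol"
  shows "Poly_Mapping.lookup (P * Q) 0 = Poly_Mapping.lookup P 0 * Poly_Mapping.lookup Q 0"
proof -
  have eq: "\<alpha> + \<beta> = 0 \<longleftrightarrow> \<alpha> = 0 \<and> \<beta> = 0" for \<alpha> \<beta> :: "nat \<Rightarrow>\<^sub>0 nat"
    by (auto simp: poly_mapping_eq_iff fun_eq_iff lookup_add)
  have "Poly_Mapping.lookup (P * Q) 0 = (\<Sum>\<alpha> \<in> Poly_Mapping.keys P. \<Sum>\<beta> \<in> Poly_Mapping.keys Q.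
     if \<alpha> = 0 then if \<beta> = 0 then Poly_Mapping.lookup P 0 * Poly_Mapping.lookup Q 0 else 0 else 0)"
    unfolding lookup_times when_def eq by (intro sum.cong refl) auto
  also have "\<dots> = (\<Sum>\<alpha> \<in> Poly_Mapping.keys P.
     if \<alpha> = 0 then \<Sum>\<beta> \<in> Poly_Mapping.keys Q. if \<beta> = 0 then Poly_Mapping.lookup P 0 * Poly_Mapping.lookup Q 0 else 0 else 0)"
    by (intro sum.cong refl) auto
  also have "\<dots> = Poly_Mapping.lookup P 0 * Poly_Mapping.lookup Q 0"
    by (simp add: in_keys_iff)
  finally show ?thesis .
qed

lemma variable_neq_zero: "Poly_Mapping.single i (Suc 0) \<noteq> 0"
  by (metis lookup_single_eq lookup_zero nat.simps(3))

text \<open>Setting \<open>y = 0\<close> in \<open>P(x + y)\<close> gives \<open>P(x)\<close>.\<close>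

lemma lookup_taylor_zero: "Poly_Mapping.lookup (taylor P) 0 = P"
proof -
  have "Poly_Mapping.lookup (taylor P) 0 = (\<Sum>\<alpha> \<in> Poly_Mapping.keys P.
      Poly_Mapping.single 0 (Poly_Mapping.lookup P \<alpha>) * Poly_Mapping.single \<alpha> 1)"
    unfolding taylor_def lookup_sum lookup_times_zero
    by (subst monomial_value_image[where h = "\<lambda>F. Poly_Mapping.lookup F 0"])
      (simp_all add: lookup_times_zero lookup_add lookup_single_not_eq variable_neq_zero monomial_value_variables[simplified])
  also have "\<dots> = P"
    by (simp add: mult_single flip: poly_mapping_expansion)
  finally show ?thesis .
qed

text \<open>
  Applying a map to the coefficients of a product may make keys disappear, so the product formula
  is needed for index sets larger than the sets of keys.
\<close>

lemma lookup_times_superset: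
  fixes P Q :: "'a::comm_ring_1 mpol"
  assumes "finite A" "finite B" "Poly_Mapping.keys P \<subseteq> A" "Poly_Mapping.keys Q \<subseteq> B"
  shows "Poly_Mapping.lookup (P * Q) \<gamma> = (\<Sum>\<alpha> \<in> A. \<Sum>\<beta> \<in> B.
    Poly_Mapping.lookup P \<alpha> * Poly_Mapping.lookup Q \<beta> when \<alpha> + \<beta> = \<gamma>)"
proof -
  have inner: "(\<Sum>\<beta> \<in> Poly_Mapping.keys Q. Poly_Mapping.lookup P \<alpha> * Poly_Mapping.lookup Q \<beta> when \<alpha> + \<beta> = \<gamma>)
      = (\<Sum>\<beta> \<in> B. Poly_Mapping.lookup P \<alpha> * Poly_Mapping.lookup Q \<beta> when \<alpha> + \<beta> = \<gamma>)" for \<alpha>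
    by (rule sum.mono_neutral_left) (use assms in \<open>auto simp: in_keys_iff\<close>)
  show ?thesis
    unfolding lookup_times inner
    by (rule sum.mono_neutral_left) (use assms in \<open>auto simp: in_keys_iff\<close>)
qed

text \<open>This is the specialization \<open>x = 0\<close>, which leaves a polynomial in the variables \<open>y\<^sub>i\<close>.\<close>

definition constants_of_coeffs :: "'a::comm_ring_1 mpol mpol \<Rightarrow> 'a mpol" where
  "constants_of_coeffs F = Poly_Mapping.map (\<lambda>h. Poly_Mapping.lookup h 0) F"

lemma lookup_constants_of_coeffs:
  "Poly_Mapping.lookup (constants_of_coeffs F) \<gamma> = Poly_Mapping.lookup (Poly_Mapping.lookup F \<gamma>) 0"
  by (simp add: constants_of_coeffs_def map.rep_eq when_def)

lemma constants_of_coeffs_single: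
  "constants_of_coeffs (Poly_Mapping.single \<gamma> h) = Poly_Mapping.single \<gamma> (Poly_Mapping.lookup h 0)"
  by (rule poly_mapping_eqI) (simp add: lookup_constants_of_coeffs lookup_single when_def)

lemma constants_of_coeffs_add:
  "constants_of_coeffs (F + G) = constants_of_coeffs F + constants_of_coeffs G"
  by (rule poly_mapping_eqI) (simp add: lookup_constants_of_coeffs lookup_add)

lemma constants_of_coeffs_sum:
  "constants_of_coeffs (\<Sum>x \<in> A. f x) = (\<Sum>x \<in> A. constants_of_coeffs (f x))"
  by (rule poly_mapping_eqI) (simp add: lookup_constants_of_coeffs lookup_sum)

lemma constants_of_coeffs_mult:
  "constants_of_coeffs (F * G) = constants_of_coeffs F * constants_of_coeffs G"
proof (rule poly_mapping_eqI)
  fix \<gamma>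
  have keys: "Poly_Mapping.keys (constants_of_coeffs H) \<subseteq> Poly_Mapping.keys H" for H :: "'a mpol mpol"
    by (auto simp: in_keys_iff lookup_constants_of_coeffs)
  show "Poly_Mapping.lookup (constants_of_coeffs (F * G)) \<gamma>
      = Poly_Mapping.lookup (constants_of_coeffs F * constants_of_coeffs G) \<gamma>"
    unfolding lookup_times_superset[OF finite_keys finite_keys keys keys]
    unfolding lookup_constants_of_coeffs
    unfolding lookup_times[of F G] lookup_sum
    by (intro sum.cong refl) (simp add: when_def lookup_times_zero)
qed

text \<open>Setting \<open>x = 0\<close> in \<open>P(x + y)\<close> gives \<open>P(y)\<close>.\<close>

lemma constants_of_coeffs_taylor: "constants_of_coeffs (taylor P) = P"
proof -
  have "constants_of_coeffs (taylor P) = (\<Sum>\<alpha> \<in> Poly_Mapping.keys P.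
      Poly_Mapping.single 0 (Poly_Mapping.lookup P \<alpha>) * Poly_Mapping.single \<alpha> 1)"
    unfolding taylor_def constants_of_coeffs_sum constants_of_coeffs_mult constants_of_coeffs_single
    by (subst monomial_value_image[where h = constants_of_coeffs])
      (simp_all add: constants_of_coeffs_mult constants_of_coeffs_add constants_of_coeffs_single
        lookup_single_not_eq variable_neq_zero monomial_value_variables[simplified]
        constants_of_coeffs_single[of 0 1, simplified])
  also have "\<dots> = P"
    by (simp add: mult_single flip: poly_mapping_expansion)
  finally show ?thesis .
qed

section \<open>Weighted degree and vanishing order\<close>

definition weighted_degree :: "(nat \<Rightarrow> nat) \<Rightarrow> (nat \<Rightarrow>\<^sub>0 nat) \<Rightarrow> nat" where
  "weighted_degree w \<alpha> = (\<Sum>i \<in> Poly_Mapping.keys \<alpha>. w i * Poly_Mapping.lookup \<alpha> i)"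

lemma weighted_degree_add: "weighted_degree w (\<alpha> + \<beta>) = weighted_degree w \<alpha> + weighted_degree w \<beta>"
  unfolding weighted_degree_def
  by (rule setsum_keys_plus_distrib) (simp_all add: algebra_simps)

lemma weighted_degree_eq_0:
  assumes "\<And>i. i \<in> Poly_Mapping.keys \<alpha> \<Longrightarrow> w i > 0" "weighted_degree w \<alpha> = 0"
  shows "\<alpha> = 0"
proof -
  have "Poly_Mapping.keys \<alpha> = {}"
    using assms unfolding weighted_degree_def by (fastforce simp: in_keys_iff)
  then show ?thesis by (metis in_keys_iff lookup_zero poly_mapping_eqI empty_iff)
qed

lemma total_degree_le_weighted_degree:
  assumes "\<And>i. i \<in> Poly_Mapping.keys \<alpha> \<Longrightarrow> w i > 0"
  shows "weighted_degree (\<lambda>_. 1) \<alpha> \<le> weighted_degree w \<alpha>"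
  unfolding weighted_degree_def
  by (rule sum_mono) (use assms in \<open>simp add: Suc_leI\<close>)

text \<open>
  \<open>S\<close> is a subring of the polynomials in \<open>x\<close> and \<open>J\<close> an ideal of \<open>S\<close>.  Modulo \<open>J\<close>, the set
  \<open>order_ge k\<close> consists of the polynomials over \<open>S\<close> all of whose monomials have at least \<open>k\<close> factors
  \<open>y\<^sub>i\<close>.
\<close>

locale coefficient_ideal =
  fixes S J :: "'a::comm_ring_1 mpol set"
  assumes S_one: "1 \<in> S" and S_minus: "s \<in> S \<Longrightarrow> - s \<in> S" and S_add: "s \<in> S \<Longrightarrow> s' \<in> S \<Longrightarrow> s + s' \<in> S"
    and S_mult: "s \<in> S \<Longrightarrow> s' \<in> S \<Longrightarrow> s * s' \<in> S"
    and J_zero: "0 \<in> J" and J_sub: "J \<subseteq> S"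
    and J_add: "h \<in> J \<Longrightarrow> h' \<in> J \<Longrightarrow> h + h' \<in> J"
    and J_mult: "s \<in> S \<Longrightarrow> h \<in> J \<Longrightarrow> s * h \<in> J"
begin

definition order_ge :: "nat \<Rightarrow> 'a mpol mpol set" where
  "order_ge k = {F. (\<forall>\<gamma>. Poly_Mapping.lookup F \<gamma> \<in> S) \<and>
             (\<forall>\<gamma>. weighted_degree (\<lambda>_. 1) \<gamma> < k \<longrightarrow> Poly_Mapping.lookup F \<gamma> \<in> J)}"

lemma S_zero: "0 \<in> S" using J_zero J_sub by blast

lemma S_sum: "(\<And>a. a \<in> A \<Longrightarrow> f a \<in> S) \<Longrightarrow> (\<Sum>a \<in> A. f a) \<in> S"
  by (induction A rule: infinite_finite_induct) (auto intro: S_add S_zero)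

lemma J_sum: "(\<And>a. a \<in> A \<Longrightarrow> f a \<in> J) \<Longrightarrow> (\<Sum>a \<in> A. f a) \<in> J"
  by (induction A rule: infinite_finite_induct) (auto intro: J_add J_zero)

lemma J_mult_right: "h \<in> J \<Longrightarrow> s \<in> S \<Longrightarrow> h * s \<in> J"
  using J_mult[of s h] by (simp add: mult.commute)

lemma lookup_times_in_J:
  fixes F G :: "'a mpol mpol"
  assumes "\<And>\<alpha> \<beta>. \<alpha> + \<beta> = \<gamma> \<Longrightarrow> Poly_Mapping.lookup F \<alpha> * Poly_Mapping.lookup G \<beta> \<in> J"
  shows "Poly_Mapping.lookup (F * G) \<gamma> \<in> J"
  unfolding lookup_times by (intro J_sum) (use assms J_zero in \<open>simp add: when_def\<close>)

lemma order_ge_add: "F \<in> order_ge k \<Longrightarrow> G \<in> order_ge k \<Longrightarrow> F + G \<in> order_ge k"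
  by (auto simp: order_ge_def lookup_add intro: S_add J_add)

lemma order_ge_0_mult: "F \<in> order_ge 0 \<Longrightarrow> G \<in> order_ge 0 \<Longrightarrow> F * G \<in> order_ge 0"
  by (auto simp: order_ge_def lookup_times when_def intro!: S_sum S_mult S_zero)

lemma order_ge_subset: "k \<le> l \<Longrightarrow> order_ge l \<subseteq> order_ge k"
  by (auto simp: order_ge_def)

text \<open>
  If \<open>\<alpha> + \<beta>\<close> has total degree at most \<open>k\<close>, then \<open>\<alpha> = 0\<close> or \<open>\<beta>\<close> has total degree below \<open>k\<close>; in both
  cases one of the two coefficients is in \<open>J\<close>.
\<close>

lemma order_ge_mult:
  assumes F: "F \<in> order_ge 1" and G: "G \<in> order_ge k"
  shows "F * G \<in> order_ge (Suc k)"
proof -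
  have "F * G \<in> order_ge 0"
    using F G order_ge_subset[of 0] by (intro order_ge_0_mult) auto
  moreover have "Poly_Mapping.lookup (F * G) \<gamma> \<in> J" if "weighted_degree (\<lambda>_. 1) \<gamma> < Suc k" for \<gamma>
  proof (rule lookup_times_in_J)
    fix \<alpha> \<beta> :: "nat \<Rightarrow>\<^sub>0 nat" assume "\<alpha> + \<beta> = \<gamma>"
    then have "weighted_degree (\<lambda>_. 1) \<alpha> < 1 \<or> weighted_degree (\<lambda>_. 1) \<beta> < k"
      using that by (auto simp: weighted_degree_add)
    then show "Poly_Mapping.lookup F \<alpha> * Poly_Mapping.lookup G \<beta> \<in> J"
      using F G J_mult J_mult_right unfolding order_ge_def by blast
  qed
  ultimately show ?thesis by (simp add: order_ge_def)
qed

text \<open>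
  The argument of lowest terms: in the coefficient of \<open>y\<^sup>\<gamma>\<close> of \<open>T F\<close>, all terms other than the
  constant coefficient of \<open>T\<close> times the coefficient of \<open>y\<^sup>\<gamma>\<close> of \<open>F\<close> involve coefficients of \<open>F\<close> of
  smaller total degree, which are known to be in \<open>J\<close>.
\<close>

lemma order_ge_cancel:
  assumes T: "T \<in> order_ge 0" and F: "F \<in> order_ge 0" and TF: "T * F \<in> order_ge k"
    and cancel: "\<And>h. h \<in> S \<Longrightarrow> Poly_Mapping.lookup T 0 * h \<in> J \<Longrightarrow> h \<in> J"
  shows "F \<in> order_ge k"
proof -
  have "weighted_degree (\<lambda>_. 1) \<gamma> < k \<longrightarrow> Poly_Mapping.lookup F \<gamma> \<in> J" for \<gamma>
  proof (induction "weighted_degree (\<lambda>_. 1) \<gamma>" arbitrary: \<gamma> rule: less_induct)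
    case less
    show ?case
    proof
      assume \<gamma>: "weighted_degree (\<lambda>_. 1) \<gamma> < k"
      \<comment> \<open>removing the constant coefficient of \<open>T\<close> leaves terms that are already under control\<close>
      define T' where "T' = T - Poly_Mapping.single 0 (Poly_Mapping.lookup T 0)"
      have "Poly_Mapping.lookup (T' * F) \<gamma> \<in> J"
      proof (rule lookup_times_in_J)
        fix \<alpha> \<beta> :: "nat \<Rightarrow>\<^sub>0 nat" assume ab: "\<alpha> + \<beta> = \<gamma>"
        show "Poly_Mapping.lookup T' \<alpha> * Poly_Mapping.lookup F \<beta> \<in> J"
        proof (cases "\<alpha> = 0")
          case True
          then show ?thesis by (simp add: T'_def lookup_minus J_zero)
        next
          case False
          then have "weighted_degree (\<lambda>_. 1) \<alpha> > 0"
            using weighted_degree_eq_0[of \<alpha> "\<lambda>_. 1"] by auto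
          then have "weighted_degree (\<lambda>_. 1) \<beta> < weighted_degree (\<lambda>_. 1) \<gamma>"
            using ab by (auto simp: weighted_degree_add)
          then have "Poly_Mapping.lookup F \<beta> \<in> J"
            using less \<gamma> by auto
          then show ?thesis
            using T False by (auto simp: T'_def lookup_minus lookup_single order_ge_def intro: J_mult)
        qed
      qed
      then have "- 1 * Poly_Mapping.lookup (T' * F) \<gamma> \<in> J"
        by (intro J_mult S_minus S_one)
      moreover have "Poly_Mapping.lookup (T * F) \<gamma> \<in> J"
        using TF \<gamma> by (simp add: order_ge_def)
      ultimately have "Poly_Mapping.lookup (T * F) \<gamma> + - 1 * Poly_Mapping.lookup (T' * F) \<gamma> \<in> J"
        by (rule J_add[rotated])
      also have "Poly_Mapping.lookup (T * F) \<gamma> + - 1 * Poly_Mapping.lookup (T' * F) \<gamma>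
          = Poly_Mapping.lookup ((T - T') * F) \<gamma>"
        by (simp add: left_diff_distrib lookup_minus)
      also have "\<dots> = Poly_Mapping.lookup T 0 * Poly_Mapping.lookup F \<gamma>"
        by (simp add: T'_def flip: mult_map_scale_conv_mult) (simp add: map.rep_eq when_def)
      finally show "Poly_Mapping.lookup F \<gamma> \<in> J"
        using cancel F by (simp add: order_ge_def)
    qed
  qed
  then show ?thesis using F by (simp add: order_ge_def)
qed

end

section \<open>The polynomial ring and its finitely generated subalgebras\<close>

lemma mpoly_ring_simps [simp]:
  "monoid.mult (mpoly_ring m) = (*)" "ring.add (mpoly_ring m) = (+)"
  "\<one>\<^bsub>mpoly_ring m\<^esub> = 1" "\<zero>\<^bsub>mpoly_ring m\<^esub> = 0"
  by (simp_all add: mpoly_ring_def ring_of_type_algebra_def fun_eq_iff)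

lemma mem_mpoly_ring:
  "P \<in> carrier (mpoly_ring m) \<longleftrightarrow> (\<forall>\<alpha> \<in> Poly_Mapping.keys P. Poly_Mapping.keys \<alpha> \<subseteq> {1..m})"
  by (simp add: mpoly_ring_def)

lemma mpoly_ring_closed:
  fixes P Q :: "'a::comm_ring_1 mpol"
  assumes "P \<in> carrier (mpoly_ring m)" "Q \<in> carrier (mpoly_ring m)"
  shows "P + Q \<in> carrier (mpoly_ring m)" "- P \<in> carrier (mpoly_ring m)"
    "P * Q \<in> carrier (mpoly_ring m)"
proof -
  show "P + Q \<in> carrier (mpoly_ring m)"
    using assms keys_add[of P Q] by (fastforce simp: mem_mpoly_ring)
  show "- P \<in> carrier (mpoly_ring m)"
    using assms(1) by (simp add: mem_mpoly_ring in_keys_iff)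
  show "P * Q \<in> carrier (mpoly_ring m)"
    unfolding mem_mpoly_ring
  proof
    fix \<gamma> assume "\<gamma> \<in> Poly_Mapping.keys (P * Q)"
    then obtain \<alpha> \<beta> where "\<gamma> = \<alpha> + \<beta>" "\<alpha> \<in> Poly_Mapping.keys P" "\<beta> \<in> Poly_Mapping.keys Q"
      using keys_mult[of P Q] by blast
    then show "Poly_Mapping.keys \<gamma> \<subseteq> {1..m}"
      using assms keys_add[of \<alpha> \<beta>] unfolding mem_mpoly_ring by blast
  qed
qed

lemma single_mem_mpoly_ring:
  "Poly_Mapping.keys \<alpha> \<subseteq> {1..m} \<Longrightarrow> Poly_Mapping.single \<alpha> c \<in> carrier (mpoly_ring m)"
  by (simp add: mem_mpoly_ring)

lemma one_mem_mpoly_ring: "1 \<in> carrier (mpoly_ring m)"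
  using single_mem_mpoly_ring[of 0 m 1] by simp

lemma zero_mem_mpoly_ring: "0 \<in> carrier (mpoly_ring m)"
  by (simp add: mem_mpoly_ring)

lemma a_inv_eq_uminus:
  fixes R :: "'a::ab_group_add ring"
  assumes "ring R" "ring.add R = (+)" "\<zero>\<^bsub>R\<^esub> = 0" "r \<in> carrier R"
  shows "\<ominus>\<^bsub>R\<^esub> r = - r"
proof -
  interpret ring R by fact
  show ?thesis using r_neg[OF assms(4)] assms(2,3) by (simp add: eq_neg_iff_add_eq_0 add.commute)
qed

lemma ring_of_type_algebra_simps [simp]:
  "carrier ring_of_type_algebra = UNIV"
  "monoid.mult ring_of_type_algebra = (*)" "ring.add ring_of_type_algebra = (+)"
  "\<one>\<^bsub>ring_of_type_algebra\<^esub> = 1" "\<zero>\<^bsub>ring_of_type_algebra\<^esub> = 0"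
  by (simp_all add: ring_of_type_algebra_def)

lemma cring_mpoly_ring: "cring (mpoly_ring m :: 'a::comm_ring_1 mpol ring)"
proof -
  let ?U = "ring_of_type_algebra :: 'a mpol ring"
  interpret U: cring ?U by (rule cring_from_type_algebra)
  have "\<ominus>\<^bsub>?U\<^esub> P = - P" for P
    by (rule a_inv_eq_uminus[OF U.ring_axioms]) simp_all
  then have "subring (carrier (mpoly_ring m)) ?U"
    by (intro U.subringI) (simp_all add: mpoly_ring_closed one_mem_mpoly_ring)
  then have "cring (?U\<lparr>carrier := carrier (mpoly_ring m)\<rparr>)"
    using U.subcringI' U.subcring_iff[of "carrier (mpoly_ring m)"] by simp
  then show ?thesis by (simp add: mpoly_ring_def)
qed

lemma subalgebra_ring_simps [simp]:
  "monoid.mult (subalgebra_ring m F) = (*)" "ring.add (subalgebra_ring m F) = (+)"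
  "\<one>\<^bsub>subalgebra_ring m F\<^esub> = 1" "\<zero>\<^bsub>subalgebra_ring m F\<^esub> = 0"
  by (simp_all add: subalgebra_ring_def)

lemma carrier_subalgebra_ring:
  "carrier (subalgebra_ring m F) = generate_ring (mpoly_ring m) (range (Poly_Mapping.single 0) \<union> F)"
  by (simp add: subalgebra_ring_def)

lemma single_mem_subalgebra_ring: "Poly_Mapping.single 0 c \<in> carrier (subalgebra_ring m F)"
  by (auto simp: carrier_subalgebra_ring intro: generate_ring.incl)

lemma generator_mem_subalgebra_ring: "F \<subseteq> carrier (subalgebra_ring m F)"
  by (auto simp: carrier_subalgebra_ring intro: generate_ring.incl)

context
  fixes m and F :: "'a::comm_ring_1 mpol set"
  assumes F: "F \<subseteq> carrier (mpoly_ring m)"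
begin

lemma generators_subset: "range (Poly_Mapping.single 0) \<union> F \<subseteq> carrier (mpoly_ring m)"
  using F single_mem_mpoly_ring[of 0] by auto

lemma subalgebra_ring_subset: "carrier (subalgebra_ring m F) \<subseteq> carrier (mpoly_ring m)"
proof -
  interpret cring "mpoly_ring m :: 'a mpol ring" by (rule cring_mpoly_ring)
  show ?thesis
    unfolding carrier_subalgebra_ring by (rule generate_ring_incl[OF generators_subset])
qed

lemma cring_subalgebra_ring: "cring (subalgebra_ring m F)"
proof -
  interpret cring "mpoly_ring m :: 'a mpol ring" by (rule cring_mpoly_ring)
  show ?thesis
    using subcringI'[OF generate_ring_is_subring[OF generators_subset]]
      subcring_iff[OF generate_ring_incl[OF generators_subset]]
    by (simp add: subalgebra_ring_def)
qed

end

text \<open>Taking constant terms is multiplicative, so its kernel in the subalgebra is an ideal.\<close>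

lemma Idl_const_zero:
  fixes F :: "'a::comm_ring_1 mpol set"
  assumes F: "F \<subseteq> carrier (mpoly_ring m)"
    and const: "\<And>P. P \<in> F \<Longrightarrow> Poly_Mapping.lookup P 0 = 0"
    and a: "a \<in> Idl\<^bsub>subalgebra_ring m F\<^esub> F"
  shows "Poly_Mapping.lookup a 0 = 0"
proof -
  let ?R = "subalgebra_ring m F"
  interpret R: cring ?R by (rule cring_subalgebra_ring[OF F])
  let ?K = "{r \<in> carrier ?R. Poly_Mapping.lookup r 0 = 0}"
  have inv: "\<ominus>\<^bsub>?R\<^esub> r = - r" if "r \<in> carrier ?R" for r
    by (rule a_inv_eq_uminus[OF R.ring_axioms]) (simp_all add: that)
  have "ideal ?K ?R"
  proof (rule idealI)
    show "subgroup ?K (add_monoid ?R)"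
    proof (rule R.add.subgroupI)
      show "\<ominus>\<^bsub>?R\<^esub> r \<in> ?K" if "r \<in> ?K" for r
        using that R.a_inv_closed[of r] by (simp add: inv)
      show "r \<oplus>\<^bsub>?R\<^esub> r' \<in> ?K" if "r \<in> ?K" "r' \<in> ?K" for r r'
        using that R.a_closed[of r r'] by (simp add: lookup_add)
    qed (use R.zero_closed in auto)
    show "x \<otimes>\<^bsub>?R\<^esub> r \<in> ?K" "r \<otimes>\<^bsub>?R\<^esub> x \<in> ?K" if "r \<in> ?K" "x \<in> carrier ?R" for r x
      using that R.m_closed[of x r] R.m_closed[of r x] by (simp_all add: lookup_times_zero)
  qed (rule R.ring_axioms)
  moreover have "F \<subseteq> ?K"
    using const generator_mem_subalgebra_ring[of F m] by auto
  ultimately show ?thesis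
    using R.genideal_minimal[of ?K F] a by blast
qed

section \<open>Powers of ideals\<close>

context cring begin

lemma ideal_power_Suc: "I [^]\<^bsub>ideals_set R\<^esub> Suc n = (I [^]\<^bsub>ideals_set R\<^esub> n) \<cdot> I"
  by (simp add: ideals_set_def)

lemma ideal_power_0: "I [^]\<^bsub>ideals_set R\<^esub> (0::nat) = carrier R"
  by (simp add: ideals_set_def)

lemma ideal_power_ideal: "ideal I R \<Longrightarrow> ideal (I [^]\<^bsub>ideals_set R\<^esub> n) R" for n :: nat
proof (induction n)
  case 0
  then show ?case by (simp only: ideal_power_0 oneideal)
next
  case (Suc n)
  then show ?case by (simp only: ideal_power_Suc ideal_prod_is_ideal)
qed

lemma ideal_power_antimono:
  fixes k n :: nat
  assumes "ideal I R" "k \<le> n"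
  shows "I [^]\<^bsub>ideals_set R\<^esub> n \<subseteq> I [^]\<^bsub>ideals_set R\<^esub> k"
  using assms(2)
proof (induction n rule: dec_induct)
  case (step n)
  then show ?case
    using ideal_prod_inter[OF ideal_power_ideal[OF assms(1)] assms(1), of n]
    by (simp only: ideal_power_Suc) blast
qed simp

end

section \<open>Elements of a symbolic power vanish to high order\<close>

text \<open>
  The bound on the order of vanishing is a statement about any subring \<open>R\<close> that contains the
  constants and has a graded retraction \<open>\<beta>\<close> from the polynomial ring; generators of \<open>R\<close> matter
  only for the comparison of degrees with powers of an ideal.
\<close>

locale graded_retract =
  fixes m :: nat and w :: "nat \<Rightarrow> nat" and R :: "'a::comm_ring_1 mpol ring" and \<beta>
  assumes cring_R: "cring R"
    and mult_R: "monoid.mult R = (*)" and add_R: "ring.add R = (+)"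
    and one_R: "\<one>\<^bsub>R\<^esub> = 1" and zero_R: "\<zero>\<^bsub>R\<^esub> = 0"
    and R_subset: "carrier R \<subseteq> carrier (mpoly_ring m)"
    and const_R: "Poly_Mapping.single 0 c \<in> carrier R"
    and w_pos: "i \<in> {1..m} \<Longrightarrow> w i > 0"
    and \<beta>_closed: "h \<in> carrier (mpoly_ring m) \<Longrightarrow> \<beta> h \<in> carrier R"
    and \<beta>_add: "h \<in> carrier (mpoly_ring m) \<Longrightarrow> h' \<in> carrier (mpoly_ring m) \<Longrightarrow>
      \<beta> (h + h') = \<beta> h + \<beta> h'"
    and \<beta>_linear: "r \<in> carrier R \<Longrightarrow> h \<in> carrier (mpoly_ring m) \<Longrightarrow> \<beta> (r * h) = r * \<beta> h"
    and \<beta>_graded: "h \<in> homogeneous_part w k \<Longrightarrow> h \<in> carrier (mpoly_ring m) \<Longrightarrow>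
      \<beta> h \<in> homogeneous_part w k"
    and \<beta>_id: "r \<in> carrier R \<Longrightarrow> \<beta> r = r"
begin

abbreviation "C \<equiv> carrier (mpoly_ring m) :: 'a mpol set"

lemma \<beta>_zero: "\<beta> 0 = 0"
  using \<beta>_add[OF zero_mem_mpoly_ring zero_mem_mpoly_ring] by simp

text \<open>
  A monomial other than \<open>1\<close> has positive weighted degree, and so has its image; the monomials of
  degree \<open>0\<close> are constants, which \<open>\<beta>\<close> fixes.
\<close>

lemma lookup_\<beta>_zero:
  assumes "h \<in> C"
  shows "Poly_Mapping.lookup (\<beta> h) 0 = Poly_Mapping.lookup h 0"
proof -
  have single: "Poly_Mapping.lookup (\<beta> (Poly_Mapping.single \<alpha> c)) 0
      = Poly_Mapping.lookup (Poly_Mapping.single \<alpha> c) 0"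
    if \<alpha>: "Poly_Mapping.keys \<alpha> \<subseteq> {1..m}" for \<alpha> c
  proof (cases "\<alpha> = 0")
    case True
    then show ?thesis using \<beta>_id const_R by simp
  next
    case False
    have "Poly_Mapping.single \<alpha> c \<in> homogeneous_part w (weighted_degree w \<alpha>)"
      by (simp add: homogeneous_part_def weighted_degree_def)
    then have hom: "\<beta> (Poly_Mapping.single \<alpha> c) \<in> homogeneous_part w (weighted_degree w \<alpha>)"
      by (rule \<beta>_graded) (rule single_mem_mpoly_ring[OF \<alpha>])
    have "weighted_degree w \<alpha> \<noteq> 0"
      using weighted_degree_eq_0[of \<alpha> w] w_pos \<alpha> False by (meson subsetD)
    then have "0 \<notin> Poly_Mapping.keys (\<beta> (Poly_Mapping.single \<alpha> c))"
      using hom by (auto simp: homogeneous_part_def)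
    then show ?thesis using False by (simp add: in_keys_iff lookup_single_not_eq)
  qed
  have "Poly_Mapping.lookup (\<beta> (\<Sum>\<alpha> \<in> A. Poly_Mapping.single \<alpha> (c \<alpha>))) 0
      = Poly_Mapping.lookup (\<Sum>\<alpha> \<in> A. Poly_Mapping.single \<alpha> (c \<alpha>)) 0
    \<and> (\<Sum>\<alpha> \<in> A. Poly_Mapping.single \<alpha> (c \<alpha>)) \<in> C"
    if "finite A" "\<forall>\<alpha> \<in> A. Poly_Mapping.keys \<alpha> \<subseteq> {1..m}" for A c
    using that
  proof induction
    case empty
    then show ?case by (simp add: \<beta>_zero zero_mem_mpoly_ring)
  next
    case (insert \<alpha> A)
    then show ?case
      using single[of \<alpha>] by (simp add: \<beta>_add single_mem_mpoly_ring mpoly_ring_closed lookup_add)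
  qed
  from this[OF finite_keys, of h "Poly_Mapping.lookup h"] show ?thesis
    using assms by (simp add: mem_mpoly_ring flip: poly_mapping_expansion)
qed

text \<open>
  The preimage of \<open>Q\<close> under \<open>\<beta>\<close> is only an \<open>R\<close>-submodule of \<open>S\<close>; this is the largest ideal of \<open>S\<close>
  inside it.
\<close>

definition retract_ideal :: "'a mpol set \<Rightarrow> 'a mpol set" where
  "retract_ideal Q = {h \<in> C. \<forall>g \<in> C. \<beta> (g * h) \<in> Q}"

context
  fixes Q assumes Q: "primeideal Q R" and Q_const: "a \<in> Q \<Longrightarrow> Poly_Mapping.lookup a 0 = 0"
begin

interpretation Q: primeideal Q R by (rule Q)

lemma retract_ideal_const:
  "h \<in> retract_ideal Q \<Longrightarrow> Poly_Mapping.lookup h 0 = 0"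
  using lookup_\<beta>_zero[of h] Q_const[of "\<beta> h"] one_mem_mpoly_ring
  by (force simp: retract_ideal_def)

lemma Q_subset_retract_ideal: "Q \<subseteq> retract_ideal Q"
proof
  fix a assume a: "a \<in> Q"
  then have aR: "a \<in> carrier R" by (rule Q.Icarr)
  have "\<beta> (g * a) \<in> Q" if "g \<in> C" for g
    using Q.I_r_closed[OF a \<beta>_closed[OF that]] \<beta>_linear[OF aR that]
    by (simp add: mult_R mult.commute)
  then show "a \<in> retract_ideal Q"
    using aR R_subset by (auto simp: retract_ideal_def)
qed

lemma retract_ideal_cancel:
  assumes s: "s \<in> carrier R - Q" and h: "h \<in> C" and sh: "s * h \<in> retract_ideal Q"
  shows "h \<in> retract_ideal Q"
proof -
  have "\<beta> (g * h) \<in> Q" if g: "g \<in> C" for g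
  proof -
    have "g * (s * h) = s * (g * h)"
      by (simp add: ac_simps)
    then have "\<beta> (g * (s * h)) = s * \<beta> (g * h)"
      using \<beta>_linear[OF DiffD1[OF s] mpoly_ring_closed(3)[OF g h]] by (simp only:)
    moreover have "\<beta> (g * (s * h)) \<in> Q"
      using sh g by (simp add: retract_ideal_def)
    ultimately have "s \<otimes>\<^bsub>R\<^esub> \<beta> (g * h) \<in> Q"
      by (simp add: mult_R)
    then show ?thesis
      using Q.I_prime[of s "\<beta> (g * h)"] s \<beta>_closed mpoly_ring_closed(3)[OF g h] by auto
  qed
  then show ?thesis using h by (simp add: retract_ideal_def)
qed

interpretation coefficient_ideal C "retract_ideal Q"
proof
  have Qadd: "a + b \<in> Q" if "a \<in> Q" "b \<in> Q" for a b
    using additive_subgroup.a_closed[OF Q.is_additive_subgroup that] by (simp add: add_R)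
  have Q0: "0 \<in> Q"
    using additive_subgroup.zero_closed[OF Q.is_additive_subgroup] by (simp add: zero_R)
  show "0 \<in> retract_ideal Q"
    by (simp add: retract_ideal_def \<beta>_zero Q0 zero_mem_mpoly_ring)
  show "h + h' \<in> retract_ideal Q" if "h \<in> retract_ideal Q" "h' \<in> retract_ideal Q" for h h'
    using that by (simp add: retract_ideal_def mpoly_ring_closed distrib_left \<beta>_add Qadd)
  show "s * h \<in> retract_ideal Q" if "s \<in> C" "h \<in> retract_ideal Q" for s h
    using that by (simp add: retract_ideal_def mpoly_ring_closed flip: mult.assoc)
qed (auto simp: retract_ideal_def mpoly_ring_closed one_mem_mpoly_ring)

lemma single_mem_order_ge_0: "h \<in> C \<Longrightarrow> Poly_Mapping.single \<gamma> h \<in> order_ge 0"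
  by (auto simp: order_ge_def lookup_single when_def zero_mem_mpoly_ring)

lemma taylor_mem_order_ge_0:
  assumes "P \<in> C"
  shows "taylor P \<in> order_ge 0"
proof -
  have sum: "(\<And>a. a \<in> A \<Longrightarrow> F a \<in> order_ge 0) \<Longrightarrow> (\<Sum>a \<in> A. F a) \<in> order_ge 0" if "finite A"
    for A :: "(nat \<Rightarrow>\<^sub>0 nat) set" and F
    using that
  proof induction
    case empty
    then show ?case by (simp add: order_ge_def zero_mem_mpoly_ring)
  next
    case (insert a A)
    then show ?case by (simp add: order_ge_add)
  qed
  have one: "1 \<in> order_ge 0"
    using single_mem_order_ge_0[OF one_mem_mpoly_ring, of 0] by simp
  have pow: "F \<in> order_ge 0 \<Longrightarrow> F ^ n \<in> order_ge 0" for F and n :: nat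
    by (induction n) (auto intro: one order_ge_0_mult)
  have prod: "(\<And>a. a \<in> A \<Longrightarrow> F a \<in> order_ge 0) \<Longrightarrow> (\<Prod>a \<in> A. F a) \<in> order_ge 0" if "finite A"
    for A :: "nat set" and F
    using that by induction (auto intro: one order_ge_0_mult)
  have "i \<in> {1..m}" if "\<alpha> \<in> Poly_Mapping.keys P" "i \<in> Poly_Mapping.keys \<alpha>" for \<alpha> i
    using assms that unfolding mem_mpoly_ring by blast
  then show ?thesis
    unfolding taylor_def monomial_value_def
    by (intro sum order_ge_0_mult prod pow order_ge_add single_mem_order_ge_0 single_mem_mpoly_ring one_mem_mpoly_ring finite_keys)
      auto
qed

lemma taylor_mem_order_ge_1:
  assumes "a \<in> Q"
  shows "taylor a \<in> order_ge 1"
proof -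
  have "taylor a \<in> order_ge 0"
    using Q.Icarr[OF assms] R_subset by (intro taylor_mem_order_ge_0) auto
  moreover have "Poly_Mapping.lookup (taylor a) \<gamma> \<in> retract_ideal Q"
    if "weighted_degree (\<lambda>_. 1) \<gamma> < 1" for \<gamma>
  proof -
    have "\<gamma> = 0"
      using weighted_degree_eq_0[of \<gamma> "\<lambda>_. 1"] that by simp
    then show ?thesis
      using assms Q_subset_retract_ideal by (auto simp: lookup_taylor_zero)
  qed
  ultimately show ?thesis
    unfolding order_ge_def by blast
qed

lemma taylor_ideal_power:
  "r \<in> Q [^]\<^bsub>ideals_set R\<^esub> N \<Longrightarrow> taylor r \<in> order_ge N" for N :: nat
proof (induction N arbitrary: r)
  case 0
  then show ?case
    using R_subset by (auto simp only: Q.ideal_power_0 intro: taylor_mem_order_ge_0)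
next
  case (Suc N)
  from Suc.prems have "r \<in> (Q [^]\<^bsub>ideals_set R\<^esub> N) \<cdot>\<^bsub>R\<^esub> Q"
    by (simp only: Q.ideal_power_Suc)
  then show ?case
  proof induction
    case (prod i j)
    then have "taylor j * taylor i \<in> order_ge (Suc N)"
      by (intro order_ge_mult taylor_mem_order_ge_1 Suc.IH)
    then show ?case by (simp add: mult_R taylor_mult mult.commute)
  next
    case (sum r1 r2)
    then show ?case by (simp add: add_R taylor_add order_ge_add)
  qed
qed

text \<open>
  The expansion of \<open>s r\<close> has order at least \<open>N\<close> modulo \<open>retract_ideal Q\<close>, and \<open>s\<close> can be cancelled.
  So the coefficient of \<open>y\<^sup>\<alpha>\<close> in \<open>r(x + y)\<close> has constant term \<open>0\<close> for \<open>\<alpha>\<close> of total degree below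
  \<open>N\<close>, and this constant term is the coefficient of \<open>x\<^sup>\<alpha>\<close> in \<open>r\<close>.
\<close>

lemma symbolic_power_order:
  assumes r: "r \<in> symbolic_power R Q N" and \<alpha>: "\<alpha> \<in> Poly_Mapping.keys r"
  shows "N \<le> weighted_degree (\<lambda>_. 1) \<alpha>"
proof (rule ccontr)
  assume less: "\<not> N \<le> weighted_degree (\<lambda>_. 1) \<alpha>"
  have rR: "r \<in> carrier R" using r by (simp add: symbolic_power_def)
  obtain s where s: "s \<in> carrier R - Q" "s \<otimes>\<^bsub>R\<^esub> r \<in> Q [^]\<^bsub>ideals_set R\<^esub> N"
    using Q.extended_ideal_contraction[OF Q.ideal_power_ideal[OF Q.is_ideal] rR] r
    unfolding symbolic_power_def by blast
  have "taylor s * taylor r \<in> order_ge N"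
    using taylor_ideal_power[OF s(2)] by (simp add: mult_R taylor_mult)
  moreover have "taylor s \<in> order_ge 0" "taylor r \<in> order_ge 0"
    using s(1) rR R_subset by (auto intro: taylor_mem_order_ge_0)
  ultimately have "taylor r \<in> order_ge N"
    using order_ge_cancel[of "taylor s" "taylor r" N] retract_ideal_cancel[OF s(1)]
    by (simp add: lookup_taylor_zero)
  then have "Poly_Mapping.lookup (taylor r) \<alpha> \<in> retract_ideal Q"
    using less by (simp add: order_ge_def)
  then have "Poly_Mapping.lookup (constants_of_coeffs (taylor r)) \<alpha> = 0"
    unfolding lookup_constants_of_coeffs by (rule retract_ideal_const)
  then show False
    using \<alpha> by (simp add: constants_of_coeffs_taylor in_keys_iff)
qed

end
end

section \<open>Elements of high degree lie in powers of the irrelevant ideal\<close>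

text \<open>
  Keeping the list of factors of each product gives access both to its degree and to the number of
  its factors.
\<close>

inductive_set monomial_span :: "(nat \<Rightarrow> 'a::comm_ring_1 mpol) \<Rightarrow> nat set \<Rightarrow> 'a mpol set"
  for f I where
    zero: "0 \<in> monomial_span f I"
  | step: "set js \<subseteq> I \<Longrightarrow> P \<in> monomial_span f I \<Longrightarrow>
      Poly_Mapping.single 0 c * prod_list (map f js) + P \<in> monomial_span f I"

lemma monomial_span_monomial:
  "set js \<subseteq> I \<Longrightarrow> Poly_Mapping.single 0 c * prod_list (map f js) \<in> monomial_span f I"
  using monomial_span.step[OF _ monomial_span.zero, of js I c f] by simp

lemma monomial_span_add:
  "P \<in> monomial_span f I \<Longrightarrow> Q \<in> monomial_span f I \<Longrightarrow> P + Q \<in> monomial_span f I"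
  by (induction rule: monomial_span.induct) (auto simp: add.assoc intro: monomial_span.step)

lemma monomial_span_mult_monomial:
  assumes "P \<in> monomial_span f I" "set ks \<subseteq> I"
  shows "Poly_Mapping.single 0 c * prod_list (map f ks) * P \<in> monomial_span f I"
  using assms(1)
proof induction
  case (step js P d)
  have "Poly_Mapping.single 0 c * prod_list (map f ks) * (Poly_Mapping.single 0 d * prod_list (map f js) + P)
      = (Poly_Mapping.single 0 c * Poly_Mapping.single 0 d) * prod_list (map f (ks @ js))
        + Poly_Mapping.single 0 c * prod_list (map f ks) * P"
    by (simp add: algebra_simps)
  also have "\<dots> \<in> monomial_span f I"
    unfolding mult_single add_0_right using step assms(2) by (intro monomial_span.step) auto
  finally show ?case .
qed (simp add: monomial_span.zero)

lemma monomial_span_mult: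
  assumes "P \<in> monomial_span f I" "Q \<in> monomial_span f I"
  shows "P * Q \<in> monomial_span f I"
  using assms(1)
  by induction (simp_all add: monomial_span.zero distrib_right monomial_span_add
    monomial_span_mult_monomial assms(2))

lemma subalgebra_ring_subset_monomial_span:
  fixes f :: "nat \<Rightarrow> 'a::comm_ring_1 mpol"
  assumes f: "f ` I \<subseteq> carrier (mpoly_ring m)"
  shows "carrier (subalgebra_ring m (f ` I)) \<subseteq> monomial_span f I"
proof
  have const: "Poly_Mapping.single 0 c \<in> monomial_span f I" for c
    using monomial_span_monomial[of "[]" I c f] by simp
  have gen: "f j \<in> monomial_span f I" if "j \<in> I" for j
    using monomial_span_monomial[of "[j]" I 1 f] that by simp
  interpret S: cring "mpoly_ring m :: 'a mpol ring" by (rule cring_mpoly_ring)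
  fix r assume "r \<in> carrier (subalgebra_ring m (f ` I))"
  then have "r \<in> generate_ring (mpoly_ring m) (range (Poly_Mapping.single 0) \<union> f ` I)"
    by (simp add: carrier_subalgebra_ring)
  then show "r \<in> monomial_span f I"
  proof induction
    case one
    then show ?case using const[of 1] by simp
  next
    case (incl h)
    then show ?case using const gen by auto
  next
    case (a_inv h)
    have "h \<in> carrier (mpoly_ring m)"
      by (rule S.generate_ring_in_carrier[OF generators_subset[OF f] a_inv.hyps])
    then have "\<ominus>\<^bsub>mpoly_ring m\<^esub> h = Poly_Mapping.single 0 (- 1) * h"
      by (simp add: a_inv_eq_uminus S.ring_axioms single_uminus)
    then show ?case
      using monomial_span_mult[OF const a_inv.IH] by simp
  qed (simp_all add: monomial_span_add monomial_span_mult)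
qed

lemma homogeneous_part_mult:
  assumes P: "P \<in> homogeneous_part w k" and Q: "Q \<in> homogeneous_part w l"
  shows "P * Q \<in> homogeneous_part w (k + l)"
proof -
  have "weighted_degree w \<gamma> = k + l" if "\<gamma> \<in> Poly_Mapping.keys (P * Q)" for \<gamma>
  proof -
    obtain \<alpha> \<beta> where "\<gamma> = \<alpha> + \<beta>" "\<alpha> \<in> Poly_Mapping.keys P" "\<beta> \<in> Poly_Mapping.keys Q"
      using \<open>\<gamma> \<in> Poly_Mapping.keys (P * Q)\<close> keys_mult[of P Q] by blast
    then show ?thesis
      using P Q by (simp add: weighted_degree_add homogeneous_part_def flip: weighted_degree_def)
  qed
  then show ?thesis by (simp add: homogeneous_part_def flip: weighted_degree_def)
qed

lemma const_homogeneous: "Poly_Mapping.single 0 c \<in> homogeneous_part w 0"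
  by (simp add: homogeneous_part_def)

lemma prod_list_homogeneous:
  assumes "\<And>j. j \<in> set js \<Longrightarrow> f j \<in> homogeneous_part w (d j)"
  shows "prod_list (map f js) \<in> homogeneous_part w (sum_list (map d js))"
  using assms
proof (induction js)
  case Nil
  then show ?case using const_homogeneous[of 1] by simp
next
  case (Cons j js)
  then show ?case by (simp add: homogeneous_part_mult)
qed

text \<open>
  An element of the span is a sum \<open>h + l\<close> where \<open>h\<close> collects the products of degree at least \<open>n D\<close>
  and \<open>l\<close> the others.  A product of degree at least \<open>n D\<close> has at least \<open>n\<close> factors, so \<open>h\<close> is in
  the power of the ideal.  If \<open>r = h + l\<close> has no monomials of degree below \<open>n D\<close>, then \<open>l = 0\<close>,
  because the degrees occurring in \<open>h\<close> and in \<open>l\<close> are disjoint.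
\<close>

lemma high_degree_mem_ideal_power:
  fixes f :: "nat \<Rightarrow> 'a::comm_ring_1 mpol" and I :: "nat set" and m n D :: nat
  defines "R \<equiv> subalgebra_ring m (f ` I)"
  assumes f: "f ` I \<subseteq> carrier (mpoly_ring m)"
    and homogeneous: "\<And>j. j \<in> I \<Longrightarrow> f j \<in> homogeneous_part w (d j)"
    and D: "\<And>j. j \<in> I \<Longrightarrow> d j \<le> D" "D > 0"
    and r: "r \<in> carrier R"
    and degree: "\<And>\<alpha>. \<alpha> \<in> Poly_Mapping.keys r \<Longrightarrow> n * D \<le> weighted_degree w \<alpha>"
  shows "r \<in> (Idl\<^bsub>R\<^esub> (f ` I)) [^]\<^bsub>ideals_set R\<^esub> n"
proof -
  interpret R: cring R
    unfolding R_def by (rule cring_subalgebra_ring[OF f])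
  have R_simps: "monoid.mult R = (*)" "ring.add R = (+)" "\<one>\<^bsub>R\<^esub> = 1" "\<zero>\<^bsub>R\<^esub> = 0"
    by (simp_all add: R_def)
  let ?q = "Idl\<^bsub>R\<^esub> (f ` I)"
  have gens: "f ` I \<subseteq> carrier R"
    unfolding R_def by (rule generator_mem_subalgebra_ring)
  have q: "ideal ?q R" by (rule R.genideal_ideal[OF gens])
  interpret qn: ideal "?q [^]\<^bsub>ideals_set R\<^esub> n" R by (rule R.ideal_power_ideal[OF q])
  have mon: "prod_list (map f js) \<in> ?q [^]\<^bsub>ideals_set R\<^esub> length js" if "set js \<subseteq> I" for js
    using that
  proof (induction js)
    case Nil
    then show ?case
      using R.one_closed unfolding list.size R.ideal_power_0 by (simp add: R_simps)
  next
    case (Cons j js)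
    then have "prod_list (map f js) \<otimes>\<^bsub>R\<^esub> f j \<in> (?q [^]\<^bsub>ideals_set R\<^esub> length js) \<cdot>\<^bsub>R\<^esub> ?q"
      using R.genideal_self[OF gens] by (intro ideal_prod.prod) auto
    then show ?case
      unfolding list.size add_Suc_right add_0_right R.ideal_power_Suc
      by (simp add: R_simps mult.commute)
  qed
  have "\<exists>h l. P = h + l \<and> h \<in> ?q [^]\<^bsub>ideals_set R\<^esub> n \<and>
      (\<forall>\<alpha> \<in> Poly_Mapping.keys h. n * D \<le> weighted_degree w \<alpha>) \<and>
      (\<forall>\<alpha> \<in> Poly_Mapping.keys l. weighted_degree w \<alpha> < n * D)" if "P \<in> monomial_span f I" for P
    using that
  proof induction
    case zero
    show ?case
      using additive_subgroup.zero_closed[OF qn.is_additive_subgroup] by (intro exI[of _ 0]) (simp add: R_simps)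
  next
    case (step js P c)
    then obtain h l where P: "P = h + l" "h \<in> ?q [^]\<^bsub>ideals_set R\<^esub> n"
      "\<forall>\<alpha> \<in> Poly_Mapping.keys h. n * D \<le> weighted_degree w \<alpha>"
      "\<forall>\<alpha> \<in> Poly_Mapping.keys l. weighted_degree w \<alpha> < n * D" by blast
    define M where "M = Poly_Mapping.single 0 c * prod_list (map f js)"
    have "M \<in> homogeneous_part w (0 + sum_list (map d js))"
      unfolding M_def using step homogeneous
      by (intro homogeneous_part_mult const_homogeneous prod_list_homogeneous) auto
    then have deg: "\<forall>\<alpha> \<in> Poly_Mapping.keys M. weighted_degree w \<alpha> = sum_list (map d js)"
      by (simp add: homogeneous_part_def weighted_degree_def)
    show ?case
    proof (cases "n * D \<le> sum_list (map d js)")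
      case True
      have "M \<in> ?q [^]\<^bsub>ideals_set R\<^esub> n"
      proof -
        have "sum_list (map d js) \<le> length js * D"
          using sum_list_mono[of js d "\<lambda>_. D"] step D by (auto simp: sum_list_triv)
        then have "n \<le> length js"
          \<comment> \<open>\<open>n D \<le> deg \<le> D \<cdot> length js\<close>\<close>
          using True le_trans[of "n * D" _ "length js * D"] \<open>D > 0\<close> by simp
        then have "prod_list (map f js) \<in> ?q [^]\<^bsub>ideals_set R\<^esub> n"
          using mon[of js] step R.ideal_power_antimono[OF q] by blast
        then show ?thesis
          using qn.I_l_closed single_mem_subalgebra_ring[of c m "f ` I"]
          by (simp add: M_def R_simps flip: R_def)
      qed
      then have "M + h \<in> ?q [^]\<^bsub>ideals_set R\<^esub> n"
        using additive_subgroup.a_closed[OF qn.is_additive_subgroup _ P(2)] by (simp add: R_simps)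
      moreover have "\<forall>\<alpha> \<in> Poly_Mapping.keys (M + h). n * D \<le> weighted_degree w \<alpha>"
        using P(3) deg True keys_add[of M h] by fastforce
      ultimately show ?thesis
        using P by (intro exI[of _ "M + h"] exI[of _ l]) (simp add: M_def add.assoc)
    next
      case False
      have "\<forall>\<alpha> \<in> Poly_Mapping.keys (M + l). weighted_degree w \<alpha> < n * D"
        using P(4) deg False keys_add[of M l] by fastforce
      then show ?thesis
        using P by (intro exI[of _ h] exI[of _ "M + l"]) (simp add: M_def ac_simps)
    qed
  qed
  then obtain h l where hl: "r = h + l" "h \<in> ?q [^]\<^bsub>ideals_set R\<^esub> n"
      "\<forall>\<alpha> \<in> Poly_Mapping.keys h. n * D \<le> weighted_degree w \<alpha>"
      "\<forall>\<alpha> \<in> Poly_Mapping.keys l. weighted_degree w \<alpha> < n * D"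
    using subalgebra_ring_subset_monomial_span[OF f] r unfolding R_def by blast
  have "Poly_Mapping.lookup l \<alpha> = 0" for \<alpha>
  proof (rule ccontr)
    assume "Poly_Mapping.lookup l \<alpha> \<noteq> 0"
    then have "weighted_degree w \<alpha> < n * D" using hl(4) by (simp add: in_keys_iff)
    then have "\<alpha> \<notin> Poly_Mapping.keys r" "\<alpha> \<notin> Poly_Mapping.keys h"
      using degree hl(3) by fastforce+
    then show False
      using hl(1) \<open>Poly_Mapping.lookup l \<alpha> \<noteq> 0\<close> by (simp add: in_keys_iff lookup_add)
  qed
  then have "l = 0" by (intro poly_mapping_eqI) simp
  then show ?thesis using hl by simp
qed

section \<open>Symbolic powers of primes below the irrelevant ideal\<close>

theorem theorem3p2:
  fixes p m t D :: nat
    and w d :: "nat \<Rightarrow> nat"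
    and A :: "'a::idom ring"
    and S R :: "'a mpol ring"
    and f :: "nat \<Rightarrow> 'a mpol"
    and \<qq> :: "'a mpol set"
  assumes p: "Factorial_Ring.prime p"
    and A_def: "A = ring_of_type_algebra"
    and A: "A \<simeq> \<Z> \<or>
            discrete_valuation_ring A \<and> uniformizer A ([p] \<cdot>\<^bsub>A\<^esub> \<one>\<^bsub>A\<^esub>) \<and> (\<exists>\<delta>. p_derivation A p \<delta>)"
    and S_def: "S = mpoly_ring m"
    and w_pos: "\<And>i. i \<in> {1..m} \<Longrightarrow> w i > 0"
    and t: "t \<ge> 1"
    and f_in: "\<And>j. j \<in> {1..t} \<Longrightarrow> f j \<in> carrier S"
    and f_homogeneous: "\<And>j. j \<in> {1..t} \<Longrightarrow> f j \<in> homogeneous_part w (d j)"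
    and d_pos: "\<And>j. j \<in> {1..t} \<Longrightarrow> d j > 0"
    and R_def: "R = subalgebra_ring m (f ` {1..t})"
    and summand: "graded_direct_summand (homogeneous_part w) R S"
    and q_def: "\<qq> = Idl\<^bsub>R\<^esub> (f ` {1..t})"
    and D_def: "D = Max (d ` {1..t})"
  shows "\<forall>n \<ge> 1. \<forall>Q. primeideal Q R \<and> Q \<subseteq> \<qq> \<longrightarrow>
           symbolic_power R Q (n * D) \<subseteq> \<qq> [^]\<^bsub>ideals_set R\<^esub> n"
proof (intro allI impI subsetI)
  fix n :: nat and Q r
  assume Q: "primeideal Q R \<and> Q \<subseteq> \<qq>" and r: "r \<in> symbolic_power R Q (n * D)"
  have F: "f ` {1..t} \<subseteq> carrier (mpoly_ring m)"
    using f_in unfolding S_def by blast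
  obtain \<beta> where \<beta>_hom: "\<beta> \<in> hom (add_monoid S) (add_monoid R)"
    and \<beta>: "(\<forall>r \<in> carrier R. \<forall>s \<in> carrier S. \<beta> (r \<otimes>\<^bsub>S\<^esub> s) = r \<otimes>\<^bsub>R\<^esub> \<beta> s) \<and>
      (\<forall>k. \<beta> ` (homogeneous_part w k \<inter> carrier S) \<subseteq> homogeneous_part w k \<inter> carrier R) \<and>
      (\<forall>r \<in> carrier R. \<beta> r = r)"
    using summand unfolding graded_direct_summand_def by (rule bexE)
  note \<beta>_linear = conjunct1[OF \<beta>] and \<beta>_graded = conjunct1[OF conjunct2[OF \<beta>]]
    and \<beta>_id = conjunct2[OF conjunct2[OF \<beta>]]
  interpret graded_retract m w R \<beta>
  proof (rule graded_retract.intro)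
    show "cring R" unfolding R_def by (rule cring_subalgebra_ring[OF F])
    show "carrier R \<subseteq> carrier (mpoly_ring m)" unfolding R_def by (rule subalgebra_ring_subset[OF F])
    show "Poly_Mapping.single 0 c \<in> carrier R" for c
      unfolding R_def by (rule single_mem_subalgebra_ring)
    show "\<beta> h \<in> carrier R" if "h \<in> carrier (mpoly_ring m)" for h
      using hom_in_carrier[OF \<beta>_hom, of h] that by (simp add: S_def)
    show "\<beta> (h + h') = \<beta> h + \<beta> h'"
      if "h \<in> carrier (mpoly_ring m)" "h' \<in> carrier (mpoly_ring m)" for h h'
      using hom_mult[OF \<beta>_hom, of h h'] that by (simp add: S_def R_def)
    show "\<beta> (r * h) = r * \<beta> h" if "r \<in> carrier R" "h \<in> carrier (mpoly_ring m)" for r h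
      using \<beta>_linear that by (simp add: S_def R_def)
    show "\<beta> h \<in> homogeneous_part w k"
      if "h \<in> homogeneous_part w k" "h \<in> carrier (mpoly_ring m)" for h k
      using spec[OF \<beta>_graded, of k] that by (auto simp: S_def)
  qed (use w_pos \<beta>_id in \<open>simp_all add: R_def\<close>)
  have const: "Poly_Mapping.lookup P 0 = 0" if "P \<in> f ` {1..t}" for P
  proof -
    obtain j where j: "j \<in> {1..t}" "P = f j" using \<open>P \<in> f ` {1..t}\<close> by blast
    then have "0 \<notin> Poly_Mapping.keys P"
      using f_homogeneous[OF j(1)] d_pos[OF j(1)] by (auto simp: homogeneous_part_def)
    then show ?thesis by (simp add: in_keys_iff)
  qed
  have Q_const: "Poly_Mapping.lookup a 0 = 0" if "a \<in> Q" for a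
    by (rule Idl_const_zero[OF F const]) (use that Q in \<open>auto simp: q_def R_def\<close>)
  have d_le: "d j \<le> D" if "j \<in> {1..t}" for j
    unfolding D_def using that by (intro Max_ge) auto
  have "D > 0"
    using d_le[of 1] d_pos[of 1] t by simp
  have rR: "r \<in> carrier R"
    using r by (simp add: symbolic_power_def)
  have "n * D \<le> weighted_degree w \<alpha>" if \<alpha>: "\<alpha> \<in> Poly_Mapping.keys r" for \<alpha>
  proof -
    have keys: "Poly_Mapping.keys \<alpha> \<subseteq> {1..m}"
      using subsetD[OF R_subset rR] \<alpha> unfolding mem_mpoly_ring by (rule bspec)
    have "n * D \<le> weighted_degree (\<lambda>_. 1) \<alpha>"
      using symbolic_power_order[OF conjunct1[OF Q] Q_const r \<alpha>] by simp
    also have "\<dots> \<le> weighted_degree w \<alpha>"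
      by (intro total_degree_le_weighted_degree w_pos) (rule subsetD[OF keys])
    finally show ?thesis .
  qed
  then show "r \<in> \<qq> [^]\<^bsub>ideals_set R\<^esub> n"
    using high_degree_mem_ideal_power[OF F f_homogeneous d_le \<open>D > 0\<close>, of r n] rR
    by (simp add: R_def q_def)
qed
end
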